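(* Let $H$ be a positive selfadjoint operator in the Hilbert space $\mathcal{H}$, with trivial null space. Let $\mathcal{G}$ be a Hilbert space and let $T$ be a closed, densely defined operator from $\mathcal{H}$ to $\mathcal{G}$ such that $\operatorname{Ran}(T)$ is dense in $\mathcal{G}$ and $H=T^*T$. Let $\mathcal{D}(T)$, $|\cdot|_T$, $(\cdot,\cdot)_T$, $i_T$ and $\mathcal{R}(T^* )$, $\|\cdot\|_{T^*}$, $j_{T^*}$ be as defined in the context. Then: (i) The Hilbert space $\mathcal{D}(T)$ is closely embedded in $\mathcal{H}$ with its closed embedding $i_T$ having range dense in $\mathcal{H}$, and its kernel operator $A=i_Ti_T^*$ coincides with $H^{-1}$. (ii) $\mathcal{H}$ is closely embedded in the Hilbert space $\mathcal{R}(T^* )$ with its closed embedding $j_{T^*}^{-1}$ having range dense in $\mathcal{R}(T^* )$. The kernel operator $B=j_{T^*}^{-1}(j_{T^*}^{-1})^*$ of this closed embedding is unitarily equivalent to $A=H^{-1}$. (iii) The operator $i_T^*|_{\operatorname{Ran}(T^* )}$, viewed as an operator from $\mathcal{R}(T^* )$ to $\mathcal{D}(T)$, extends uniquely to a unitary operator $\widetilde A\colon\mathcal{R}(T^* )\to\mathcal{D}(T)$. In addition, $\widetilde A$ is also the unique unitary extension of the kernel operator $A$, when $A$ is viewed as an operator acting from $\mathcal{R}(T^* )$ and valued in $\mathcal{D}(T)$. (iv) The operator $H$ can be viewed as a linear operator with domain dense in $\mathcal{D}(T)$ and range dense in $\mathcal{R}(T^* )$; as such it is isometric, it extends uniquely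 to a unitary operator $\widetilde H\colon\mathcal{D}(T)\to\mathcal{R}(T^* )$, and $\widetilde H=\widetilde A^{-1}$. (v) Letting $V_T\colon\mathcal{G}\to\mathcal{D}(T)$ denote the unitary operator such that $T^{-1}=i_TV_T$ and $U_{T^*}\colon\mathcal{G}\to\mathcal{R}(T^* )$ denote the unitary operator such that $T^*=j_{T^*}U_{T^*}$, we have $\widetilde H=U_{T^*}V_T^{-1}$. (vi) The operator $\Theta\colon\mathcal{R}(T^* )\to\mathcal{D}(T)^*$ defined by $(\Theta\alpha)(x)=(\widetilde A\alpha,x)_T$, for $\alpha\in\mathcal{R}(T^* )$ and $x\in\mathcal{D}(T)$, provides a canonical (unitary) identification of the Hilbert space $\mathcal{R}(T^* )$ with the conjugate dual space $\mathcal{D}(T)^*$ and, for all $y\in\operatorname{Ran}(T^* )$, $$\|y\|_{T^*}=\sup\Bigl\{\frac{|\langle y,x\rangle_{\mathcal{H}}|}{|x|_T}\;\Big|\; x\in\operatorname{Dom}(T)\setminus\{0\}\Bigr\}.$$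
   Context: All Hilbert spaces are complex, with inner products linear in the first variable; operators may be unbounded. "Positive" means $\langle Hx,x\rangle\ge 0$ for all $x\in\operatorname{Dom}(H)$. For an injective operator $S$, $S^{-1}$ is its algebraic inverse, with $\operatorname{Dom}(S^{-1})=\operatorname{Ran}(S)$. Closely embedded Hilbert space: a Hilbert space $\mathcal{H}_+$ is closely embedded in a Hilbert space $\mathcal{H}$ if there is a linear manifold $\mathcal{D}\subseteq\mathcal{H}_+\cap\mathcal{H}$ (on which the algebraic structures of $\mathcal{H}_+$ and $\mathcal{H}$ agree), dense in $\mathcal{H}_+$, such that the embedding operator $j_+$ with $\operatorname{Dom}(j_+)=\mathcal{D}$, $j_+x=x$, is closed as an operator from $\mathcal{H}_+$ to $\mathcal{H}$. The operator $j_+$ is called the closed embedding and $j_+j_+^*$ its kernel operator. The space $\mathcal{D}(T)$: for $T$ closed, densely defined and injective from $\mathcal{H}$ to $\mathcal{G}$, $\mathcal{D}(T)$ is the Hilbert space completion of $\operatorname{Dom}(T)$ with respect to the norm $|x|_T=\|Tx\|_{\mathcal{G}}$, with inner product $(x,y)_T=\langle Tx,Ty\rangle_{\mathcal{G}}$. The operator $i_T$ has domain $\operatorname{Dom}(T)\subseteq\mathcal{D}(T)$, takes values in $\mathcal{H}$, and is given by $i_Tx=x$. (Here $T$ is injective because $H=T^*T$ has trivial null space.) The space $\mathcal{R}(S)$: for a closed, densely defined operator $S$ from $\mathcal{G}$ to $\mathcal{H}$, $\mathcal{R}(S)$ is the Hilbert space completion of $\operatorname{Ran}(S)$ with respect to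 the inner product $\langle Sx,Sy\rangle_S=\langle x,y\rangle_{\mathcal{G}}$ for $x,y\in\operatorname{Dom}(S)$ with $x,y\perp\operatorname{Null}(S)$; its norm is denoted $\|\cdot\|_S$. The operator $j_S$ has domain $\operatorname{Ran}(S)\subseteq\mathcal{R}(S)$, takes values in $\mathcal{H}$, and is given by $j_Su=u$. This is applied with $S=T^*$. $\mathcal{D}(T)^*$ is the conjugate dual of $\mathcal{D}(T)$, i.e. the space of continuous conjugate-linear functionals on $\mathcal{D}(T)$ with the dual norm. *)

theory Defs
  imports "HOL-Analysis.Analysis"
begin

section \<open>Complex Hilbert spaces\<close>

text \<open>
  A complex Hilbert space is a complete real inner product space (so that norm, topology and
  completeness are those of the library) with a compatible complex structure. The complex inner
  product is linear in its first argument and its real part is the underlying real inner product;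
  in particular \<open>norm x = sqrt (Re (cinner x x))\<close>. The zero space is allowed.
\<close>

class complex_hilbert = real_inner + complete_space +
  fixes scaleC :: "complex \<Rightarrow> 'a \<Rightarrow> 'a" (infixr "*\<^sub>C" 75)
    and cinner :: "'a \<Rightarrow> 'a \<Rightarrow> complex"
  assumes scaleC_add_right: "a *\<^sub>C (x + y) = a *\<^sub>C x + a *\<^sub>C y"
    and scaleC_add_left: "(a + b) *\<^sub>C x = a *\<^sub>C x + b *\<^sub>C x"
    and scaleC_scaleC: "a *\<^sub>C (b *\<^sub>C x) = (a * b) *\<^sub>C x"
    and scaleR_scaleC: "r *\<^sub>R x = complex_of_real r *\<^sub>C x"
    and cinner_add_left: "cinner (x + y) z = cinner x z + cinner y z"
    and cinner_scaleC_left: "cinner (a *\<^sub>C x) y = a * cinner x y"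
    and cinner_commute: "cinner x y = cnj (cinner y x)"
    and inner_eq_Re_cinner: "inner x y = Re (cinner x y)"

instantiation complex :: complex_hilbert
begin

definition scaleC_complex :: "complex \<Rightarrow> complex \<Rightarrow> complex"
  where "scaleC_complex a x = a * x"

definition cinner_complex :: "complex \<Rightarrow> complex \<Rightarrow> complex"
  where "cinner_complex x y = x * cnj y"

instance
  by standard
    (simp_all add: scaleC_complex_def cinner_complex_def algebra_simps scaleR_conv_of_real
      inner_complex_def)

end


section \<open>Unbounded operators\<close>

text \<open>
  An operator is identified with its graph. Hence equality of operators includes equality of
  domains, \<open>S \<subseteq> T\<close> says that \<open>T\<close> extends \<open>S\<close>, the algebraic inverse of an injective operator
  \<open>S\<close> is the converse relation \<open>S\<inverse>\<close> (with domain \<open>Range S\<close>), a closed operator is one whose graph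
  is \<^const>\<open>closed\<close> in the product topology, and products of operators, with their natural
  (maximal) domain, are products of relations.
\<close>

type_synonym ('a, 'b) op = "('a \<times> 'b) set"

abbreviation op_comp :: "('b, 'c) op \<Rightarrow> ('a, 'b) op \<Rightarrow> ('a, 'c) op" (infixr "\<circ>\<^sub>o" 75)
  where "S \<circ>\<^sub>o T \<equiv> T O S"

definition graph_of :: "('a \<Rightarrow> 'b) \<Rightarrow> ('a, 'b) op"
  where "graph_of f = {(x, f x) |x. True}"

definition linear_operator :: "('a::complex_hilbert, 'b::complex_hilbert) op \<Rightarrow> bool"
  where "linear_operator T \<longleftrightarrow>
    single_valued T \<and> (0, 0) \<in> T \<and>
    (\<forall>x u y v. (x, u) \<in> T \<longrightarrow> (y, v) \<in> T \<longrightarrow> (x + y, u + v) \<in> T) \<and>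
    (\<forall>c x u. (x, u) \<in> T \<longrightarrow> (c *\<^sub>C x, c *\<^sub>C u) \<in> T)"

definition injective_op :: "('a, 'b) op \<Rightarrow> bool"
  where "injective_op T \<longleftrightarrow> single_valued (T\<inverse>)"

definition dense :: "'a::topological_space set \<Rightarrow> bool"
  where "dense A \<longleftrightarrow> closure A = UNIV"

definition null_space :: "('a, 'b::zero) op \<Rightarrow> 'a set"
  where "null_space T = {x. (x, 0) \<in> T}"

text \<open>For densely defined \<open>T\<close> the following relation is the graph of the adjoint operator.\<close>

definition adj :: "('a::complex_hilbert, 'b::complex_hilbert) op \<Rightarrow> ('b, 'a) op"
  where "adj T = {(y, z). \<forall>(x, u) \<in> T. cinner u y = cinner x z}"

definition selfadjoint :: "('a::complex_hilbert, 'a) op \<Rightarrow> bool"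
  where "selfadjoint H \<longleftrightarrow> linear_operator H \<and> dense (Domain H) \<and> adj H = H"

definition positive_op :: "('a::complex_hilbert, 'a) op \<Rightarrow> bool"
  where "positive_op H \<longleftrightarrow> (\<forall>(x, u) \<in> H. cinner u x \<in> \<real> \<and> 0 \<le> Re (cinner u x))"

definition isometric_op :: "('a::complex_hilbert, 'b::complex_hilbert) op \<Rightarrow> bool"
  where "isometric_op T \<longleftrightarrow> (\<forall>(x, u) \<in> T. norm u = norm x)"

definition clinear_on ::
    "'a::complex_hilbert set \<Rightarrow> ('a \<Rightarrow> 'b::complex_hilbert) \<Rightarrow> bool"
  where "clinear_on D f \<longleftrightarrow>
    (\<forall>x\<in>D. \<forall>y\<in>D. f (x + y) = f x + f y) \<and> (\<forall>c. \<forall>x\<in>D. f (c *\<^sub>C x) = c *\<^sub>C f x)"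

definition unitary :: "('a::complex_hilbert \<Rightarrow> 'b::complex_hilbert) \<Rightarrow> bool"
  where "unitary U \<longleftrightarrow>
    clinear_on UNIV U \<and> (\<forall>x y. cinner (U x) (U y) = cinner x y) \<and> surj U"

definition unitary_extensions ::
    "('a::complex_hilbert, 'b::complex_hilbert) op \<Rightarrow> ('a \<Rightarrow> 'b) set"
  where "unitary_extensions F = {U. unitary U \<and> F \<subseteq> graph_of U}"

definition unitarily_equivalent ::
    "('a::complex_hilbert, 'a) op \<Rightarrow> ('b::complex_hilbert, 'b) op \<Rightarrow> bool"
  where "unitarily_equivalent A B \<longleftrightarrow>
    (\<exists>W. unitary W \<and> B = {(W x, W y) |x y. (x, y) \<in> A})"


section \<open>Closely embedded Hilbert spaces\<close>

text \<open>
  Two Hilbert spaces given by different types have no common elements, so a linear manifold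
  \<open>\<D>\<close> contained in both is given by an identification of a linear manifold of the one with a
  linear manifold of the other that respects the algebraic structures. Under this
  identification the embedding \<open>x \<mapsto> x\<close> is an injective linear operator \<open>j\<close> with \<open>Domain j\<close> being
  \<open>\<D>\<close> as a part of the embedded space and \<open>Range j\<close> being \<open>\<D>\<close> as a part of the ambient space.
\<close>

definition closed_embedding :: "('a::complex_hilbert, 'b::complex_hilbert) op \<Rightarrow> bool"
  where "closed_embedding j \<longleftrightarrow>
    linear_operator j \<and> injective_op j \<and> dense (Domain j) \<and> closed j"

definition kernel_op :: "('a::complex_hilbert, 'b::complex_hilbert) op \<Rightarrow> ('b, 'b) op"
  where "kernel_op j = j \<circ>\<^sub>o adj j"


section \<open>The spaces \<open>\<D>(T)\<close> and \<open>\<R>(S)\<close>\<close>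

text \<open>
  The type \<open>'d\<close> together with the map \<open>\<iota>\<close>, of which only the restriction to \<open>Domain T\<close> is
  relevant, is a Hilbert space completion of \<open>Domain T\<close> for the inner product
  \<open>(x, y)\<^sub>T = \<langle>T x, T y\<rangle>\<close>; the element \<open>\<iota> x\<close> is \<open>x\<close> regarded as an element of \<open>\<D>(T)\<close>.
\<close>

definition is_D_space ::
    "('h::complex_hilbert, 'g::complex_hilbert) op \<Rightarrow> ('h \<Rightarrow> 'd::complex_hilbert) \<Rightarrow> bool"
  where "is_D_space T \<iota> \<longleftrightarrow>
    clinear_on (Domain T) \<iota> \<and>
    (\<forall>(x, u) \<in> T. \<forall>(y, v) \<in> T. cinner (\<iota> x) (\<iota> y) = cinner u v) \<and>
    dense (\<iota> ` Domain T)"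

definition i_op :: "('h, 'g) op \<Rightarrow> ('h \<Rightarrow> 'd) \<Rightarrow> ('d, 'h) op"
  where "i_op T \<iota> = {(\<iota> x, x) |x. x \<in> Domain T}"

text \<open>
  Likewise for the completion of \<open>Range S\<close>, where \<open>\<langle>S x, S y\<rangle>\<^sub>S = \<langle>x, y\<rangle>\<close> for \<open>x\<close> and \<open>y\<close> in the
  domain of \<open>S\<close> and orthogonal to its null space.
\<close>

definition is_R_space ::
    "('g::complex_hilbert, 'h::complex_hilbert) op \<Rightarrow> ('h \<Rightarrow> 'r::complex_hilbert) \<Rightarrow> bool"
  where "is_R_space S \<iota> \<longleftrightarrow>
    clinear_on (Range S) \<iota> \<and>
    (\<forall>(x, u) \<in> S. \<forall>(y, v) \<in> S.
      (\<forall>n \<in> null_space S. cinner x n = 0 \<and> cinner y n = 0) \<longrightarrow>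
      cinner (\<iota> u) (\<iota> v) = cinner x y) \<and>
    dense (\<iota> ` Range S)"

definition j_op :: "('g, 'h) op \<Rightarrow> ('h \<Rightarrow> 'r) \<Rightarrow> ('r, 'h) op"
  where "j_op S \<iota> = {(\<iota> u, u) |u. u \<in> Range S}"

text \<open>
  Such completions exist: when the range of \<open>T\<close>, respectively the domain of an injective \<open>S\<close>, is
  dense, the space \<open>\<G>\<close> itself can be used.
\<close>

lemma is_D_space_exists:
  assumes T: "linear_operator T" and dense: "dense (Range T)"
  shows "is_D_space T (\<lambda>x. THE u. (x, u) \<in> T)"
proof -
  have the: "(THE u. (x, u) \<in> T) = u" if "(x, u) \<in> T" for x u
    using that T by (auto simp: linear_operator_def dest: single_valuedD)
  have "(\<lambda>x. THE u. (x, u) \<in> T) ` Domain T = Range T"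
    by (force simp: the image_iff)
  moreover have "clinear_on (Domain T) (\<lambda>x. THE u. (x, u) \<in> T)"
    unfolding clinear_on_def
  proof (intro conjI ballI allI)
    fix x y assume "x \<in> Domain T" "y \<in> Domain T"
    then obtain u v where "(x, u) \<in> T" "(y, v) \<in> T" by auto
    moreover from this have "(x + y, u + v) \<in> T"
      using T by (simp add: linear_operator_def)
    ultimately show "(THE w. (x + y, w) \<in> T) = (THE w. (x, w) \<in> T) + (THE w. (y, w) \<in> T)"
      by (simp add: the)
  next
    fix c x assume "x \<in> Domain T"
    then obtain u where "(x, u) \<in> T" by auto
    moreover from this have "(c *\<^sub>C x, c *\<^sub>C u) \<in> T"
      using T by (simp add: linear_operator_def)
    ultimately show "(THE w. (c *\<^sub>C x, w) \<in> T) = c *\<^sub>C (THE w. (x, w) \<in> T)"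
      by (simp add: the)
  qed
  ultimately show ?thesis
    using dense by (auto simp: is_D_space_def the)
qed

lemma is_R_space_exists:
  assumes S: "linear_operator S" and inj: "injective_op S" and dense: "dense (Domain S)"
  shows "is_R_space S (\<lambda>u. THE x. (x, u) \<in> S)"
proof -
  have "linear_operator (S\<inverse>)"
    using S inj by (simp add: linear_operator_def injective_op_def)
  from is_D_space_exists[OF this] dense show ?thesis
    by (fastforce simp: is_D_space_def is_R_space_def)
qed


section \<open>The conjugate dual space\<close>

definition conj_dual :: "('d::complex_hilbert \<Rightarrow> complex) set"
  where "conj_dual = {f. (\<forall>x y. f (x + y) = f x + f y) \<and>
    (\<forall>c x. f (c *\<^sub>C x) = cnj c * f x) \<and> continuous_on UNIV f}"

text \<open>
  The dual norm is the library's \<^const>\<open>onorm\<close>; the following is the inner product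
  determined by it through the polarization identity (linear in the first argument).
\<close>

definition dual_inner ::
    "('d::complex_hilbert \<Rightarrow> complex) \<Rightarrow> ('d \<Rightarrow> complex) \<Rightarrow> complex"
  where "dual_inner f g =
    (\<Sum>k<4. \<i> ^ k * complex_of_real ((onorm (\<lambda>x. f x + \<i> ^ k * g x))\<^sup>2)) / 4"

definition unitary_onto_conj_dual ::
    "('r::complex_hilbert \<Rightarrow> 'd::complex_hilbert \<Rightarrow> complex) \<Rightarrow> bool"
  where "unitary_onto_conj_dual \<Theta> \<longleftrightarrow>
    bij_betw \<Theta> UNIV conj_dual \<and>
    (\<forall>\<alpha> \<beta>. \<Theta> (\<alpha> + \<beta>) = (\<lambda>x. \<Theta> \<alpha> x + \<Theta> \<beta> x)) \<and>
    (\<forall>c \<alpha>. \<Theta> (c *\<^sub>C \<alpha>) = (\<lambda>x. c * \<Theta> \<alpha> x)) \<and>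
    (\<forall>\<alpha>. onorm (\<Theta> \<alpha>) = norm \<alpha>) \<and>
    (\<forall>\<alpha> \<beta>. dual_inner (\<Theta> \<alpha>) (\<Theta> \<beta>) = cinner \<alpha> \<beta>)"

end

theory Submission
  imports Defs
begin

text \<open>
  The assignments \<open>T x \<mapsto> x\<close> and \<open>y \<mapsto> T\<^sup>* y\<close> extend to unitary operators \<open>V\<close> from \<open>\<G>\<close> onto
  \<open>\<D>(T)\<close> and \<open>U\<close> from \<open>\<G>\<close> onto \<open>\<R>(T\<^sup>*)\<close>, so that every operator in the theorem is transported to
  one built from \<open>T\<close>, \<open>T\<^sup>*\<close>, \<open>V\<close> and \<open>U\<close>; the unitary extensions of \<open>A\<close> and \<open>H\<close> are \<open>V U\<inverse>\<close> and
  \<open>U V\<inverse>\<close>. The facts about \<open>T\<^sup>*\<close> come from the orthogonal projection onto the graph of \<open>T\<close>. The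
  kernel operator \<open>B\<close> is carried by \<open>U\<close> to the inverse of \<open>T T\<^sup>*\<close>, so that (ii) needs the unitary
  equivalence of \<open>T\<^sup>* T\<close> and \<open>T T\<^sup>*\<close>. To avoid polar decompositions of unbounded operators, it is
  obtained from the polar decomposition of the bounded operator \<open>T (1 + T\<^sup>* T)\<inverse>\<close>.
\<close>

section \<open>Hilbert spaces\<close>

text \<open>A minimising sequence for the distance is Cauchy by the parallelogram law, and its limit
  is the foot of the perpendicular. Only the real inner product enters, so the result also covers
  the graph of an operator as a subspace of a product.\<close>

lemma orthogonal_projection:
  fixes S :: "'a::{real_inner,complete_space} set"
  assumes S: "subspace S" and "closed S"
  obtains p where "p \<in> S" and "\<And>s. s \<in> S \<Longrightarrow> inner (x - p) s = 0"
proof -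
  define D where "D = Inf ((\<lambda>s. (norm (x - s))\<^sup>2) ` S)"
  have S0: "S \<noteq> {}" using S subspace_0 by auto
  have bdd: "bdd_below ((\<lambda>s. (norm (x - s))\<^sup>2) ` S)"
    by (rule bdd_belowI[of _ 0]) auto
  have D_le: "D \<le> (norm (x - s))\<^sup>2" if "s \<in> S" for s
    unfolding D_def by (rule cINF_lower[OF bdd that])
  have "\<exists>s\<in>S. (norm (x - s))\<^sup>2 < D + 1 / real (Suc n)" for n
    using cINF_less_iff[OF S0 bdd, of "D + 1 / real (Suc n)"] by (simp add: D_def)
  then obtain p where p: "\<And>n. p n \<in> S" "\<And>n. (norm (x - p n))\<^sup>2 < D + 1 / real (Suc n)"
    by metis
  have close: "(norm (p m - p n))\<^sup>2 \<le> 2 / real (Suc m) + 2 / real (Suc n)" for m n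
  proof -
    have "(1/2) *\<^sub>R (p m + p n) \<in> S"
      using p S by (intro subspace_mul subspace_add) auto
    then have "D \<le> (norm (x - (1/2) *\<^sub>R (p m + p n)))\<^sup>2" by (rule D_le)
    \<comment> \<open>Parallelogram law for \<open>x - p m\<close> and \<open>x - p n\<close>; the
      midpoint lies in \<open>S\<close>, so its squared distance from \<open>x\<close> is at least
      \<open>D\<close>.\<close>
    moreover have "(norm (p m - p n))\<^sup>2 = 2 * (norm (x - p m))\<^sup>2 + 2 * (norm (x - p n))\<^sup>2
        - 4 * (norm (x - (1/2) *\<^sub>R (p m + p n)))\<^sup>2"
      by (simp add: power2_norm_eq_inner inner_diff inner_add algebra_simps inner_commute)
    ultimately show ?thesis
      using p(2)[of m] p(2)[of n] by simp
  qed
  have "Cauchy p"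
  proof (rule metric_CauchyI)
    fix e :: real assume e: "0 < e"
    obtain N where N: "4 / e\<^sup>2 < real N"
      using reals_Archimedean2 by blast
    then have N: "4 / e\<^sup>2 < real (Suc N)" by simp
    have "dist (p m) (p n) < e" if "N \<le> m" "N \<le> n" for m n
    proof -
      have "(norm (p m - p n))\<^sup>2 \<le> 2 / real (Suc m) + 2 / real (Suc n)" by (rule close)
      also have "\<dots> \<le> 2 / real (Suc N) + 2 / real (Suc N)"
        using that by (intro add_mono divide_left_mono) auto
      also have "\<dots> = 4 / real (Suc N)" by simp
      also have "\<dots> < e\<^sup>2"
        using N e by (simp add: field_simps)
      finally show ?thesis
        using e by (simp add: dist_norm power_less_imp_less_base)
    qed
    then show "\<exists>M. \<forall>m\<ge>M. \<forall>n\<ge>M. dist (p m) (p n) < e" by blast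
  qed
  then obtain q where q: "p \<longlonglongrightarrow> q"
    using Cauchy_convergent convergent_def by blast
  have qS: "q \<in> S"
    using closed_sequentially[OF \<open>closed S\<close> _ q] p by blast
  have "(\<lambda>n. (norm (x - p n))\<^sup>2) \<longlonglongrightarrow> (norm (x - q))\<^sup>2"
    by (intro tendsto_intros q)
  moreover have "(\<lambda>n. D + 1 / real (Suc n)) \<longlonglongrightarrow> D + 0"
    by (intro tendsto_intros LIMSEQ_Suc[OF lim_1_over_n])
  ultimately have min: "(norm (x - q))\<^sup>2 \<le> D"
    using LIMSEQ_le[of _ _ "\<lambda>n. D + 1 / real (Suc n)" D] p(2) by (force intro: less_imp_le)
  have "inner (x - q) s = 0" if s: "s \<in> S" for s
  proof (cases "s = 0")
    case False
    \<comment> \<open>\<open>?t\<close> minimises the squared distance from \<open>x\<close> along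
      the line \<open>q + t *\<^sub>R s\<close>; any gain over \<open>q\<close> would contradict the
      minimality of \<open>q\<close>.\<close>
    let ?t = "inner (x - q) s / inner s s"
    have "q + ?t *\<^sub>R s \<in> S"
      using S s qS by (intro subspace_mul subspace_add) auto
    then have "(norm (x - q))\<^sup>2 \<le> (norm (x - q - ?t *\<^sub>R s))\<^sup>2"
      using D_le[of "q + ?t *\<^sub>R s"] min by (simp only: diff_diff_eq order_trans)
    also have "\<dots> = (norm (x - q))\<^sup>2 - (inner (x - q) s)\<^sup>2 / inner s s"
    proof -
      have *: "(norm (v - t *\<^sub>R s))\<^sup>2 = (norm v)\<^sup>2 - 2 * t * inner v s + t\<^sup>2 * inner s s" for v t
        unfolding power2_norm_eq_inner
        by (simp add: inner_diff_left inner_diff_right inner_commute[of s v] power2_eq_square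
            right_diff_distrib)
      show ?thesis
        using False unfolding * by (simp add: power2_eq_square field_simps)
    qed
    finally have "(inner (x - q) s)\<^sup>2 / inner s s \<le> 0" by simp
    then show ?thesis
      using False by (simp add: divide_le_0_iff inner_ge_zero[THEN antisym_conv])
  qed simp
  with qS show ?thesis by (rule that)
qed

lemma subspace_closure:
  fixes S :: "'a::real_normed_vector set"
  assumes "subspace S" shows "subspace (closure S)"
  unfolding subspace_def
proof (intro conjI ballI allI)
  show "0 \<in> closure S"
    using assms subspace_0 closure_subset by blast
next
  fix x y assume "x \<in> closure S" "y \<in> closure S"
  then obtain f g where "\<And>n. f n \<in> S" "f \<longlonglongrightarrow> x" "\<And>n. g n \<in> S" "g \<longlonglongrightarrow> y"
    unfolding closure_sequential by blast
  then have "\<And>n. f n + g n \<in> S" "(\<lambda>n. f n + g n) \<longlonglongrightarrow> x + y"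
    using assms by (auto intro: subspace_add tendsto_add)
  then show "x + y \<in> closure S"
    unfolding closure_sequential by (intro exI[of _ "\<lambda>n. f n + g n"]) simp
next
  fix c x assume "x \<in> closure S"
  then obtain f where "\<And>n. f n \<in> S" "f \<longlonglongrightarrow> x"
    unfolding closure_sequential by blast
  then have "\<And>n. c *\<^sub>R f n \<in> S" "(\<lambda>n. c *\<^sub>R f n) \<longlonglongrightarrow> c *\<^sub>R x"
    using assms by (auto intro: subspace_mul tendsto_scaleR)
  then show "c *\<^sub>R x \<in> closure S"
    unfolding closure_sequential by (intro exI[of _ "\<lambda>n. c *\<^sub>R f n"]) simp
qed

section \<open>Complex scalars and the complex inner product\<close>

lemma scaleC_one [simp]: "1 *\<^sub>C x = x"
  using scaleR_scaleC[of 1 x] by simp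

lemma scaleC_zero_left [simp]: "0 *\<^sub>C x = 0"
  using scaleR_scaleC[of 0 x] by simp

lemma scaleC_zero_right [simp]: "c *\<^sub>C (0::'a::complex_hilbert) = 0"
  using scaleC_add_right[of c 0 "0::'a"] by simp

lemma scaleC_minus_right: "c *\<^sub>C (- x) = - (c *\<^sub>C (x::'a::complex_hilbert))"
  using scaleC_add_right[of c x "- x"] by (simp add: minus_unique)

lemma scaleC_diff_right: "c *\<^sub>C (x - y) = c *\<^sub>C x - c *\<^sub>C (y::'a::complex_hilbert)"
  using scaleC_add_right[of c x "- y"] by (simp add: scaleC_minus_right)

lemma scaleC_minus_one [simp]: "(- 1) *\<^sub>C x = - x"
  using scaleR_scaleC[of "- 1" x] by simp

lemma cinner_zero_left [simp]: "cinner 0 x = 0"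
  using cinner_add_left[of 0 0 x] by simp

lemma cinner_zero_right [simp]: "cinner x 0 = 0"
  by (metis cinner_commute cinner_zero_left complex_cnj_zero)

lemma cinner_add_right: "cinner x (y + z) = cinner x y + cinner x z"
  by (metis cinner_add_left cinner_commute complex_cnj_add)

lemma cinner_scaleC_right: "cinner x (c *\<^sub>C y) = cnj c * cinner x y"
  by (metis cinner_commute cinner_scaleC_left complex_cnj_mult)

lemma cinner_minus_left: "cinner (- x) y = - cinner x y"
  using cinner_add_left[of x "- x" y] by (simp add: minus_unique)

lemma cinner_minus_right: "cinner x (- y) = - cinner x y"
  using cinner_add_right[of x y "- y"] by (simp add: minus_unique)

lemma cinner_diff_left: "cinner (x - y) z = cinner x z - cinner y z"
  using cinner_add_left[of x "- y" z] by (simp add: cinner_minus_left)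

lemma cinner_diff_right: "cinner x (y - z) = cinner x y - cinner x z"
  using cinner_add_right[of x y "- z"] by (simp add: cinner_minus_right)

lemmas cinner_simps = cinner_add_left cinner_add_right cinner_diff_left cinner_diff_right
  cinner_minus_left cinner_minus_right cinner_scaleC_left cinner_scaleC_right

text \<open>Through this formula real facts about continuity, isometry and orthogonality pass to the
  complex inner product: each is applied once to \<open>y\<close> and once to
  \<open>\<i> *\<^sub>C y\<close>.\<close>

lemma cinner_eq_Complex: "cinner x y = Complex (inner x y) (inner x (\<i> *\<^sub>C y))"
  by (simp add: complex_eq_iff inner_eq_Re_cinner cinner_scaleC_right)

lemma cinner_self: "cinner x x = complex_of_real ((norm x)\<^sup>2)"
proof -
  have "Im (cinner x x) = 0"
    using arg_cong[OF cinner_commute[of x x], of Im] by simp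
  then show ?thesis
    by (simp add: complex_eq_iff power2_norm_eq_inner inner_eq_Re_cinner)
qed

lemma cinner_self_eq_0 [simp]: "cinner x x = 0 \<longleftrightarrow> x = 0"
  by (simp add: cinner_self)

lemma norm_scaleC: "norm (c *\<^sub>C x) = cmod c * norm x"
proof -
  have "complex_of_real ((norm (c *\<^sub>C x))\<^sup>2) = complex_of_real ((cmod c * norm x)\<^sup>2)"
    by (simp only: cinner_self[symmetric] cinner_scaleC_left cinner_scaleC_right)
      (simp add: cinner_self power_mult_distrib complex_norm_square mult.commute del: of_real_power)
  then have "(norm (c *\<^sub>C x))\<^sup>2 = (cmod c * norm x)\<^sup>2"
    using of_real_eq_iff by blast
  then show ?thesis
    by (simp add: power2_eq_iff_nonneg)
qed

lemma bounded_linear_scaleC: "bounded_linear (\<lambda>x. c *\<^sub>C x)"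
proof (rule bounded_linear_intro[where K = "cmod c"])
  fix r and x :: 'a
  show "c *\<^sub>C (r *\<^sub>R x) = r *\<^sub>R (c *\<^sub>C x)"
    by (simp add: scaleR_scaleC scaleC_scaleC mult.commute)
qed (simp_all add: scaleC_add_right norm_scaleC)

lemma continuous_on_scaleC [continuous_intros]:
  "continuous_on S f \<Longrightarrow> continuous_on S (\<lambda>x. c *\<^sub>C f x)"
  by (rule bounded_linear.continuous_on[OF bounded_linear_scaleC])

lemma continuous_on_cinner [continuous_intros]:
  "continuous_on S f \<Longrightarrow> continuous_on S g \<Longrightarrow> continuous_on S (\<lambda>x. cinner (f x) (g x))"
  unfolding cinner_eq_Complex by (intro continuous_intros)

text \<open>Rotating \<open>y\<close> by the phase of \<open>cinner x y\<close> makes the modulus a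
  real inner product, to which the real Cauchy-Schwarz inequality applies.\<close>

lemma cmod_cinner_le: "cmod (cinner x y) \<le> norm x * norm y"
proof (cases "cinner x y = 0")
  case False
  let ?c = "sgn (cinner x y)"
  have "cmod ?c = 1" using False by (simp add: norm_sgn)
  have "cmod (cinner x y) = Re (cinner x y * cnj ?c)"
    using False by (simp add: sgn_eq real_sqrt_divide cmod_def power2_eq_square
        real_div_sqrt flip: add_divide_distrib)
  also have "\<dots> = inner x (?c *\<^sub>C y)"
    by (simp add: inner_eq_Re_cinner cinner_scaleC_right mult.commute)
  also have "\<dots> \<le> norm x * norm (?c *\<^sub>C y)" by (rule norm_cauchy_schwarz)
  finally show ?thesis using \<open>cmod ?c = 1\<close> by (simp add: norm_scaleC)
qed simp

text \<open>Real polarization recovers the real part from norms; compatibility with multiplication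
  by \<i> recovers the imaginary part.\<close>

lemma clinear_isometry_cinner:
  assumes f: "clinear_on UNIV f" and norm: "\<And>x. norm (f x) = norm x"
  shows "cinner (f x) (f y) = cinner x y"
proof -
  have inner: "inner (f x) (f y) = inner x y" for x y
  proof -
    have "f x + f y = f (x + y)" using f by (simp add: clinear_on_def)
    then show ?thesis by (simp add: dot_norm norm)
  qed
  have "f (\<i> *\<^sub>C y) = \<i> *\<^sub>C f y" using f by (simp add: clinear_on_def)
  then show ?thesis by (metis cinner_eq_Complex inner)
qed

section \<open>Density arguments and the Riesz representation\<close>

lemma dense_induct:
  assumes "dense S" and "closed {x. P x}" and "\<And>x. x \<in> S \<Longrightarrow> P x"
  shows "P x"
  using closure_minimal[of S "{x. P x}"] assms by (auto simp: dense_def)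

text \<open>Real orthogonality to a complex subspace is the same as complex orthogonality.\<close>

lemma dense_complex_subspace:
  fixes S :: "'a::complex_hilbert set"
  assumes add: "\<And>x y. x \<in> S \<Longrightarrow> y \<in> S \<Longrightarrow> x + y \<in> S"
    and scale: "\<And>c x. x \<in> S \<Longrightarrow> c *\<^sub>C x \<in> S" and "S \<noteq> {}"
    and orth: "\<And>k. (\<And>s. s \<in> S \<Longrightarrow> cinner s k = 0) \<Longrightarrow> k = 0"
  shows "dense S"
proof -
  have "subspace S"
    unfolding subspace_def
    using add scale \<open>S \<noteq> {}\<close> by (metis scaleR_scaleC scaleC_zero_left ex_in_conv)
  then have sub: "subspace (closure S)" by (rule subspace_closure)
  have "x \<in> closure S" for x
  proof -
    obtain p where p: "p \<in> closure S" "\<And>s. s \<in> closure S \<Longrightarrow> inner (x - p) s = 0"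
      using orthogonal_projection[OF sub closed_closure] by blast
    have "x - p = 0"
    proof (rule orth)
      fix s assume "s \<in> S"
      then have "inner (x - p) s = 0" "inner (x - p) (\<i> *\<^sub>C s) = 0"
        using p(2) scale closure_subset by blast+
      then have "cinner (x - p) s = 0" by (simp add: cinner_eq_Complex complex_eq_iff)
      then show "cinner s (x - p) = 0" by (metis cinner_commute complex_cnj_zero)
    qed
    with p show ?thesis by simp
  qed
  then show ?thesis by (auto simp: dense_def)
qed

lemma dense_orthogonal_eq_0:
  assumes "dense S" and "\<And>s. s \<in> S \<Longrightarrow> cinner s k = 0"
  shows "k = 0"
proof -
  have "closed {s. cinner s k = 0}"
    by (intro closed_Collect_eq continuous_intros)
  from dense_induct[OF assms(1) this assms(2)] have "cinner k k = 0" by blast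
  then show ?thesis by simp
qed

text \<open>If \<open>f\<close> is not zero, a vector \<open>w\<close> orthogonal to its closed
  kernel \<open>N\<close> represents it up to a scalar: every \<open>x\<close> differs from an
  element of \<open>N\<close> by a multiple of \<open>w\<close>.\<close>

lemma riesz_representation:
  fixes f :: "'a::complex_hilbert \<Rightarrow> complex"
  assumes "f \<in> conj_dual"
  obtains a where "\<And>x. f x = cinner a x"
proof -
  have add: "f (x + y) = f x + f y" and scale: "f (c *\<^sub>C x) = cnj c * f x"
    and cont: "continuous_on UNIV f" for x y c
    using assms by (auto simp: conj_dual_def)
  define N where "N = {x. f x = 0}"
  have "closed N" unfolding N_def by (intro closed_Collect_eq cont continuous_intros)
  have "subspace N"
    using scale[of 0 0] by (auto simp: subspace_def N_def add scale scaleR_scaleC)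
  show ?thesis
  proof (cases "N = UNIV")
    case True
    then show ?thesis using that[of 0] by (auto simp: N_def)
  next
    case False
    then obtain z where "z \<notin> N" by blast
    obtain p where p: "p \<in> N" "\<And>s. s \<in> N \<Longrightarrow> inner (z - p) s = 0"
      using orthogonal_projection[OF \<open>subspace N\<close> \<open>closed N\<close>] by blast
    define w where "w = z - p"
    have "f w \<noteq> 0"
      using \<open>z \<notin> N\<close> p(1) add[of w p] by (auto simp: N_def w_def)
    then have "w \<noteq> 0" using scale[of 0 0] by auto
    have orth: "cinner w s = 0" if "s \<in> N" for s
    proof -
      have "\<i> *\<^sub>C s \<in> N" using that by (simp add: N_def scale)
      with p(2) that show ?thesis by (simp add: cinner_eq_Complex complex_eq_iff w_def)
    qed
    define c where "c = complex_of_real ((norm w)\<^sup>2)"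
    have "c \<noteq> 0" "cnj c = c" using \<open>w \<noteq> 0\<close> by (simp_all add: c_def)
    show ?thesis
    proof (rule that)
      fix x
      \<comment> \<open>The coefficient is conjugated because \<open>f\<close> is conjugate-linear;
        pairing with \<open>w\<close> conjugates it back.\<close>
      have "x + (- cnj (f x / f w)) *\<^sub>C w \<in> N"
        using \<open>f w \<noteq> 0\<close> by (simp add: N_def add scale)
      then have "cinner w x = (f x / f w) * c"
        using orth[of "x + (- cnj (f x / f w)) *\<^sub>C w"]
        by (simp add: cinner_simps cinner_self c_def)
      then show "f x = cinner ((f w / c) *\<^sub>C w) x"
        using \<open>f w \<noteq> 0\<close> \<open>c \<noteq> 0\<close> by (simp add: cinner_scaleC_left)
    qed
  qed
qed

text \<open>A conjugate-linear functional is real-linear, so \<open>onorm\<close> applies to it.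
  Cauchy-Schwarz bounds it from above, and the argument \<open>a\<close> gives the bound from
  below.\<close>

lemma onorm_cinner: "onorm (cinner a) = norm a"
proof (rule antisym)
  have bound: "cmod (cinner a x) \<le> norm a * norm x" for x
    by (rule cmod_cinner_le)
  then show "onorm (cinner a) \<le> norm a"
    by (intro onorm_bound) auto
  have "bounded_linear (cinner a)"
    by (rule bounded_linear_intro[where K = "norm a"])
      (simp_all add: cinner_add_right cinner_scaleC_right scaleR_scaleC bound scaleC_complex_def
        mult.commute[of _ "norm a"])
  from le_onorm[OF this, of a] show "norm a \<le> onorm (cinner a)"
    by (simp add: cinner_self power2_eq_square norm_mult split: if_splits)
qed

section \<open>Isometric operators\<close>

lemma
  assumes "linear_operator F"
  shows linear_operator_unique: "(x, u) \<in> F \<Longrightarrow> (x, v) \<in> F \<Longrightarrow> u = v"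
    and linear_operator_0: "(0, 0) \<in> F"
    and linear_operator_add: "(x, u) \<in> F \<Longrightarrow> (y, v) \<in> F \<Longrightarrow> (x + y, u + v) \<in> F"
    and linear_operator_scaleC: "(x, u) \<in> F \<Longrightarrow> (c *\<^sub>C x, c *\<^sub>C u) \<in> F"
  using assms by (simp_all add: linear_operator_def single_valued_def)

lemma linear_operator_minus:
  "linear_operator F \<Longrightarrow> (x, u) \<in> F \<Longrightarrow> (- x, - u) \<in> F"
  using linear_operator_scaleC[of F x u "- 1"] by simp

lemma linear_operator_diff:
  "linear_operator F \<Longrightarrow> (x, u) \<in> F \<Longrightarrow> (y, v) \<in> F \<Longrightarrow> (x - y, u - v) \<in> F"
  using linear_operator_add[of F x u "- y" "- v"] linear_operator_minus[of F y v] by simp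

lemma linear_operator_converse:
  assumes "linear_operator F" and "\<And>x. (x, 0) \<in> F \<Longrightarrow> x = 0"
  shows "linear_operator (F\<inverse>)"
  unfolding linear_operator_def
proof (intro conjI allI impI)
  show "single_valued (F\<inverse>)"
  proof (rule single_valuedI)
    fix u x y assume "(u, x) \<in> F\<inverse>" "(u, y) \<in> F\<inverse>"
    then have "(x - y, 0) \<in> F"
      using linear_operator_diff[OF assms(1)] by (metis converseD diff_self)
    then show "x = y" using assms(2) by fastforce
  qed
qed (simp_all add: linear_operator_0 linear_operator_add linear_operator_scaleC assms(1))

lemma linear_operator_range_dense:
  fixes F :: "('a::complex_hilbert, 'b::complex_hilbert) op"
  assumes "linear_operator F" and "\<And>k. (\<And>x u. (x, u) \<in> F \<Longrightarrow> cinner u k = 0) \<Longrightarrow> k = 0"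
  shows "dense (Range F)"
proof (rule dense_complex_subspace)
  show "Range F \<noteq> {}" using linear_operator_0[OF assms(1)] by blast
qed (use assms in \<open>blast intro: linear_operator_add linear_operator_scaleC\<close>)+

lemma linear_operator_domain_dense:
  fixes F :: "('a::complex_hilbert, 'b::complex_hilbert) op"
  assumes "linear_operator F" and "\<And>k. (\<And>x u. (x, u) \<in> F \<Longrightarrow> cinner x k = 0) \<Longrightarrow> k = 0"
  shows "dense (Domain F)"
proof (rule dense_complex_subspace)
  show "Domain F \<noteq> {}" using linear_operator_0[OF assms(1)] by blast
qed (use assms in \<open>blast intro: linear_operator_add linear_operator_scaleC\<close>)+

section \<open>Unitary operators\<close>

lemma unitaryD:
  assumes "unitary U"
  shows unitary_add: "U (x + y) = U x + U y"
    and unitary_scaleC: "U (c *\<^sub>C x) = c *\<^sub>C U x"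
    and unitary_cinner: "cinner (U x) (U y) = cinner x y"
    and unitary_surj: "surj U"
  using assms by (auto simp: unitary_def clinear_on_def)

lemma unitary_0: "unitary U \<Longrightarrow> U 0 = 0"
  using unitary_scaleC[of U 0 0] by simp

lemma unitary_minus: "unitary U \<Longrightarrow> U (- x) = - U x"
  using unitary_scaleC[of U "- 1" x] by simp

lemma unitary_diff: "unitary U \<Longrightarrow> U (x - y) = U x - U y"
  using unitary_add[of U x "- y"] by (simp add: unitary_minus)

lemma unitary_norm: "unitary U \<Longrightarrow> norm (U x) = norm x"
  by (simp add: norm_eq_sqrt_inner inner_eq_Re_cinner unitary_cinner)

lemma unitary_bounded_linear: "unitary U \<Longrightarrow> bounded_linear U"
  by (rule bounded_linear_intro[where K = 1])
    (simp_all add: unitary_add unitary_scaleC scaleR_scaleC unitary_norm)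

lemma unitary_continuous: "unitary U \<Longrightarrow> continuous_on UNIV U"
  by (simp add: unitary_bounded_linear linear_continuous_on)

lemma unitary_inj: "unitary U \<Longrightarrow> inj U"
proof (rule injI)
  fix x y assume "unitary U" "U x = U y"
  then have "norm (x - y) = 0"
    using unitary_norm[of U "x - y"] by (simp add: unitary_diff)
  then show "x = y" by simp
qed

lemma unitary_eq_iff: "unitary U \<Longrightarrow> U x = U y \<longleftrightarrow> x = y"
  using unitary_inj by (auto dest: injD)

lemma unitary_inv_f [simp]: "unitary U \<Longrightarrow> inv U (U x) = x"
  by (simp add: unitary_inj)

lemma unitary_f_inv [simp]: "unitary U \<Longrightarrow> U (inv U x) = x"
  by (simp add: unitary_surj surj_f_inv_f)

lemma unitary_comp: "unitary U \<Longrightarrow> unitary V \<Longrightarrow> unitary (U \<circ> V)"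
  using comp_surj[of V U] unfolding unitary_def clinear_on_def by simp

lemma unitary_inv:
  assumes "unitary U" shows "unitary (inv U)"
  unfolding unitary_def clinear_on_def
proof (intro conjI ballI allI)
  fix x y c
  show "inv U (x + y) = inv U x + inv U y"
    by (simp add: inv_f_eq unitary_inj unitary_add assms)
  show "inv U (c *\<^sub>C x) = c *\<^sub>C inv U x"
    by (simp add: inv_f_eq unitary_inj unitary_scaleC assms)
  show "cinner (inv U x) (inv U y) = cinner x y"
    using unitary_cinner[OF assms, of "inv U x" "inv U y"] by (simp add: assms)
  show "surj (inv U)"
    using assms inj_imp_surj_inv unitary_inj by blast
qed

lemma unitary_image_dense:
  assumes "unitary U" and "dense S" shows "dense (U ` S)"
proof -
  have "U ` closure S \<subseteq> closure (U ` S)"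
    by (intro closure_bounded_linear_image_subset unitary_bounded_linear assms)
  with assms show ?thesis
    by (auto simp: dense_def unitary_surj)
qed



text \<open>A linear isometry is uniformly continuous, so it extends from its dense domain to the
  whole space, and its algebraic identities persist by continuity.\<close>

lemma unitary_extension_exists:
  fixes F :: "('a::complex_hilbert, 'b::complex_hilbert) op"
  assumes F: "linear_operator F" and iso: "isometric_op F"
    and dom: "dense (Domain F)" and ran: "dense (Range F)"
  obtains U where "unitary U" and "\<And>x u. (x, u) \<in> F \<Longrightarrow> U x = u"
proof -
  define f where "f x = (THE u. (x, u) \<in> F)" for x
  have f: "f x = u" if "(x, u) \<in> F" for x u
    unfolding f_def using that linear_operator_unique[OF F] by blast
  have "dist (f x) (f y) = dist x y" if "x \<in> Domain F" "y \<in> Domain F" for x y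
  proof -
    obtain u v where uv: "(x, u) \<in> F" "(y, v) \<in> F"
      using \<open>x \<in> Domain F\<close> \<open>y \<in> Domain F\<close> by blast
    then have "norm (u - v) = norm (x - y)"
      using iso linear_operator_diff[OF F] unfolding isometric_op_def by fast
    with uv show ?thesis by (simp add: f dist_norm)
  qed
  then have "uniformly_continuous_on (Domain F) f"
    unfolding uniformly_continuous_on_def by auto
  then obtain g where "uniformly_continuous_on (closure (Domain F)) g"
    and gf: "\<And>x. x \<in> Domain F \<Longrightarrow> f x = g x"
    by (rule uniformly_continuous_on_extension_on_closure) blast
  then have g: "continuous_on UNIV g"
    using dom uniformly_continuous_imp_continuous by (simp add: dense_def)
  have gF: "g x = u" if "(x, u) \<in> F" for x u
    using that f gf by (metis Domain.DomainI)
  have [continuous_intros]: "continuous_on UNIV (\<lambda>x. g (h x))"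
    if "continuous_on UNIV h" for h :: "'a \<Rightarrow> 'a"
    using that by (rule continuous_on_compose2[OF g]) simp
  have add: "g (x + y) = g x + g y" for x y
  proof (rule dense_induct[where x = x, OF dom])
    fix x assume "x \<in> Domain F"
    then obtain u where u: "(x, u) \<in> F" by blast
    show "g (x + y) = g x + g y"
    proof (rule dense_induct[where x = y, OF dom])
      fix y assume "y \<in> Domain F"
      then obtain v where "(y, v) \<in> F" by blast
      with u show "g (x + y) = g x + g y"
        using linear_operator_add[OF F] gF by metis
    qed (intro closed_Collect_eq continuous_intros)
  qed (intro closed_Collect_eq continuous_intros)
  have scale: "g (c *\<^sub>C x) = c *\<^sub>C g x" for c x
  proof (rule dense_induct[where x = x, OF dom])
    fix x assume "x \<in> Domain F"
    then show "g (c *\<^sub>C x) = c *\<^sub>C g x"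
      using linear_operator_scaleC[OF F] gF by (metis DomainE)
  qed (intro closed_Collect_eq continuous_intros)
  have norm: "norm (g x) = norm x" for x
  proof (rule dense_induct[where x = x, OF dom])
    fix x assume "x \<in> Domain F"
    then show "norm (g x) = norm x"
      using iso gF by (auto simp: isometric_op_def)
  qed (intro closed_Collect_eq continuous_intros)
  have lin: "clinear_on UNIV g" by (simp add: clinear_on_def add scale)
  have "bounded_linear g"
    by (rule bounded_linear_intro[where K = 1]) (simp_all add: add scale scaleR_scaleC norm)
  \<comment> \<open>An isometric image of a complete space is complete, hence closed; as it contains
    the dense set \<open>Range F\<close>, it is everything.\<close>
  then have "complete (range g)"
    by (intro complete_isometric_image[of 1 UNIV]) (simp_all add: norm complete_UNIV)
  then have "closure (range g) = range g" by (simp add: complete_imp_closed)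
  moreover have "Range F \<subseteq> range g" using gF by blast
  ultimately have "surj g"
    using ran closure_mono[of "Range F" "range g"] by (auto simp: dense_def)
  then have "unitary g"
    by (simp add: unitary_def lin clinear_isometry_cinner norm)
  then show ?thesis using gF by (rule that)
qed

section \<open>Adjoints of closed operators\<close>

lemma adjI: "(\<And>x u. (x, u) \<in> T \<Longrightarrow> cinner u y = cinner x z) \<Longrightarrow> (y, z) \<in> adj T"
  by (auto simp: adj_def)

lemma adjD: "(y, z) \<in> adj T \<Longrightarrow> (x, u) \<in> T \<Longrightarrow> cinner u y = cinner x z"
  by (auto simp: adj_def)

lemma adjD': "(y, z) \<in> adj T \<Longrightarrow> (x, u) \<in> T \<Longrightarrow> cinner y u = cinner z x"
  by (metis adjD cinner_commute)

lemma linear_operator_adj: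
  assumes "dense (Domain T)" shows "linear_operator (adj T)"
  unfolding linear_operator_def
proof (intro conjI allI impI)
  show "single_valued (adj T)"
  proof (rule single_valuedI)
    fix y z w assume "(y, z) \<in> adj T" "(y, w) \<in> adj T"
    then have "cinner x (z - w) = 0" if "x \<in> Domain T" for x
      using that by (metis DomainE adjD cinner_diff_right right_minus_eq)
    with assms have "z - w = 0" by (rule dense_orthogonal_eq_0)
    then show "z = w" by simp
  qed
next
  fix y z v w assume "(y, z) \<in> adj T" "(v, w) \<in> adj T"
  then show "(y + v, z + w) \<in> adj T"
    by (intro adjI) (simp add: cinner_add_right adjD)
next
  fix c y z assume "(y, z) \<in> adj T"
  then show "(c *\<^sub>C y, c *\<^sub>C z) \<in> adj T"
    by (intro adjI) (simp add: cinner_scaleC_right adjD)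
qed (auto intro: adjI)

lemma closed_adj: "closed (adj T)"
proof -
  have "adj T = (\<Inter>q\<in>T. {p. cinner (snd q) (fst p) = cinner (fst q) (snd p)})"
    by (fastforce simp: adj_def)
  also have "closed \<dots>"
    by (intro closed_INT ballI closed_Collect_eq continuous_intros)
  finally show ?thesis .
qed

lemma adj_injective: "dense (Range T) \<Longrightarrow> (y, 0) \<in> adj T \<Longrightarrow> y = 0"
  by (rule dense_orthogonal_eq_0) (auto dest: adjD)

text \<open>Von Neumann's argument: project \<open>(h, g)\<close> onto the closed graph of
  \<open>T\<close>. The residual \<open>(h - x, g - u)\<close> is orthogonal to the graph, which
  says exactly that \<open>(u - g, h - x)\<close> lies in the graph of the adjoint.\<close>

lemma graph_decomposition:
  fixes T :: "('a::complex_hilbert, 'b::complex_hilbert) op"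
  assumes T: "linear_operator T" and "closed T"
  obtains x u y z where "(x, u) \<in> T" and "(y, z) \<in> adj T" and "h = x + z" and "g = u - y"
proof -
  have "subspace T"
    using linear_operator_0[OF T] linear_operator_add[OF T] linear_operator_scaleC[OF T]
    by (auto simp: subspace_def zero_prod_def scaleR_scaleC scaleR_prod_def plus_prod_def)
  then obtain x u where xu: "(x, u) \<in> T"
    and orth: "\<And>s. s \<in> T \<Longrightarrow> inner ((h, g) - (x, u)) s = 0"
    by (metis orthogonal_projection[OF _ \<open>closed T\<close>] surj_pair)
  have "(u - g, h - x) \<in> adj T"
  proof (rule adjI)
    fix x' u' assume x': "(x', u') \<in> T"
    have *: "inner (h - x) x' = inner (u - g) u'" if "(x', u') \<in> T" for x' u'
      using orth[OF that] by (simp add: inner_diff_left)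
    \<comment> \<open>The real relation is used for the graph element and for \<i> times it, which
      supplies the imaginary part.\<close>
    have "cinner (u - g) u' = cinner (h - x) x'"
      using *[OF x'] *[OF linear_operator_scaleC[OF T x', of \<i>]]
      by (simp add: cinner_eq_Complex)
    then show "cinner u' (u - g) = cinner x' (h - x)" by (metis cinner_commute)
  qed
  from that[OF xu this] show ?thesis by simp
qed

text \<open>The residual \<open>(z, - y)\<close> of a point of the second adjoint in the
  decomposition above belongs to the second adjoint as well. Pairing it with \<open>(y, z)\<close>
  in the adjoint makes the squared norms of \<open>z\<close> and \<open>y\<close> opposite, so both
  vanish.\<close>

lemma adj_adj:
  assumes T: "linear_operator T" "closed T"
  shows "adj (adj T) = T"
proof
  show "T \<subseteq> adj (adj T)" by (auto intro!: adjI dest: adjD')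
  show "adj (adj T) \<subseteq> T"
  proof (rule subrelI)
    fix h g assume hg: "(h, g) \<in> adj (adj T)"
    obtain x u y z where xu: "(x, u) \<in> T" and yz: "(y, z) \<in> adj T"
      and h: "h = x + z" and g: "g = u - y"
      using graph_decomposition[OF T] by blast
    have "cinner z z = - cinner y y"
      using adjD[OF hg yz] adjD'[OF yz xu] by (simp add: h g cinner_simps)
    then have "(norm z)\<^sup>2 = - (norm y)\<^sup>2"
      unfolding cinner_self by (metis of_real_eq_iff of_real_minus)
    then have "z = 0" "y = 0"
      using zero_le_power2[of "norm y"] zero_le_power2[of "norm z"] by auto
    with xu h g show "(h, g) \<in> T" by simp
  qed
qed

text \<open>A vector \<open>k\<close> orthogonal to the domain gives a point \<open>(0, k)\<close>
  of the second adjoint, that is, of \<open>T\<close>. For the range, treated next, the point is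
  \<open>(k, 0)\<close>.\<close>

lemma dense_Domain_adj:
  assumes T: "linear_operator T" "closed T" and dom: "dense (Domain T)"
  shows "dense (Domain (adj T))"
proof (rule linear_operator_domain_dense[OF linear_operator_adj[OF dom]])
  fix k assume "\<And>y z. (y, z) \<in> adj T \<Longrightarrow> cinner y k = 0"
  then have "(0, k) \<in> adj (adj T)" by (auto intro: adjI)
  then have "(0, k) \<in> T" by (simp add: adj_adj T)
  then show "k = 0" using linear_operator_0 linear_operator_unique T by blast
qed

lemma dense_Range_adj:
  assumes T: "linear_operator T" "closed T" and dom: "dense (Domain T)"
    and inj: "\<And>x. (x, 0) \<in> T \<Longrightarrow> x = 0"
  shows "dense (Range (adj T))"
proof (rule linear_operator_range_dense[OF linear_operator_adj[OF dom]])
  fix k assume "\<And>y z. (y, z) \<in> adj T \<Longrightarrow> cinner z k = 0"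
  then have "(k, 0) \<in> adj (adj T)" by (auto intro: adjI)
  then show "k = 0" using inj by (simp add: adj_adj T)
qed

section \<open>Square roots of bounded positive operators\<close>

text \<open>
  The iteration \<open>Y \<mapsto> (X + Y\<^sup>2) / 2\<close> from \<open>0\<close> is dominated in norm, increment by increment, by the
  scalar iteration for \<open>X = 1\<close>, which increases to \<open>1\<close>; its limit satisfies \<open>(1 - Y)\<^sup>2 = 1 - X\<close>.
\<close>

instance complex_hilbert \<subseteq> banach ..

lemma bounded_operator_sqrt:
  fixes X :: "'a::{real_inner,banach} \<Rightarrow>\<^sub>L 'a"
  assumes X: "norm X \<le> 1" and sym: "\<And>a b. inner (X a) b = inner a (X b)"
  obtains P :: "'a \<Rightarrow>\<^sub>L 'a" where "\<And>a. P (P a) = a - X a"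
    and "\<And>a b. inner (P a) b = inner a (P b)"
    and "\<And>C. C o\<^sub>L X = X o\<^sub>L C \<Longrightarrow> C o\<^sub>L P = P o\<^sub>L C"
proof -
  interpret comp: bounded_bilinear "(o\<^sub>L) :: ('a \<Rightarrow>\<^sub>L 'a) \<Rightarrow> ('a \<Rightarrow>\<^sub>L 'a) \<Rightarrow> 'a \<Rightarrow>\<^sub>L 'a"
    by (rule bounded_bilinear_blinfun_compose)
  define Y where "Y = rec_nat (0 :: 'a \<Rightarrow>\<^sub>L 'a) (\<lambda>_ Y. (1/2) *\<^sub>R (X + (Y o\<^sub>L Y)))"
  define y where "y = rec_nat (0 :: real) (\<lambda>_ y. (1 + y\<^sup>2) / 2)"
  have Y_0: "Y 0 = 0" and Y_Suc: "Y (Suc n) = (1/2) *\<^sub>R (X + (Y n o\<^sub>L Y n))" for n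
    by (simp_all add: Y_def)
  have y_0: "y 0 = 0" and y_Suc: "y (Suc n) = (1 + (y n)\<^sup>2) / 2" for n
    by (simp_all add: y_def)
  have y_bounds: "0 \<le> y n \<and> y n \<le> 1" for n
  proof (induction n)
    case (Suc n)
    then have "(y n)\<^sup>2 \<le> 1" by (simp add: power_le_one)
    then show ?case by (simp add: y_Suc)
  qed (simp add: y_0)
  have "y n \<le> y (Suc n)" for n
    \<comment> \<open>The increment equals \<open>(1 - y n)\<^sup>2 / 2\<close>.\<close>
    using zero_le_power2[of "1 - y n"] by (simp add: y_Suc power2_diff)
  then have "incseq y" by (rule incseq_SucI)
  have norm_Y: "norm (Y n) \<le> y n" for n
  proof (induction n)
    case (Suc n)
    have "norm (Y n o\<^sub>L Y n) \<le> (y n)\<^sup>2"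
      using norm_blinfun_compose[of "Y n" "Y n"] mult_mono[OF Suc Suc] y_bounds[of n]
      by (simp add: power2_eq_square)
    then show ?case
      using norm_triangle_ineq[of X "Y n o\<^sub>L Y n"] X by (simp add: Y_Suc y_Suc)
  qed (simp add: Y_0 y_0)
  have step: "norm (Y (Suc n) - Y n) \<le> y (Suc n) - y n" for n
  proof (induction n)
    case 0
    show ?case using norm_Y[of 1] by (simp add: Y_0 y_0)
  next
    case (Suc n)
    let ?D = "Y (Suc n) - Y n" and ?d = "y (Suc n) - y n"
    \<comment> \<open>A difference of squares, factored without assuming that the factors
      commute.\<close>
    have "Y (Suc (Suc n)) - Y (Suc n) = (1/2) *\<^sub>R ((?D o\<^sub>L Y (Suc n)) + (Y n o\<^sub>L ?D))"
      unfolding Y_Suc[of "Suc n"] Y_Suc[of n, symmetric]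
      by (subst (3) Y_Suc)
        (simp add: comp.diff_left comp.diff_right algebra_simps)
    then have "norm (Y (Suc (Suc n)) - Y (Suc n)) = norm ((?D o\<^sub>L Y (Suc n)) + (Y n o\<^sub>L ?D)) / 2"
      by simp
    also have "\<dots> \<le> (norm (?D o\<^sub>L Y (Suc n)) + norm (Y n o\<^sub>L ?D)) / 2"
      by (simp add: norm_triangle_ineq)
    also have "\<dots> \<le> (norm ?D * norm (Y (Suc n)) + norm (Y n) * norm ?D) / 2"
      by (intro divide_right_mono add_mono norm_blinfun_compose) simp
    also have "\<dots> \<le> (?d * y (Suc n) + y n * ?d) / 2"
      using Suc norm_Y[of n] norm_Y[of "Suc n"] y_bounds
      by (intro divide_right_mono add_mono mult_mono)
        (auto intro: order_trans[OF norm_ge_zero] incseq_SucD[OF \<open>incseq y\<close>])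
    also have "\<dots> = y (Suc (Suc n)) - y (Suc n)"
      unfolding y_Suc[of "Suc n"] by (subst (5) y_Suc) (simp add: field_simps power2_eq_square)
    finally show ?case .
  qed
  have dist_Y: "dist (Y (n + k)) (Y n) \<le> dist (y (n + k)) (y n)" for n k
  proof -
    have "norm (Y (n + k) - Y n) \<le> y (n + k) - y n"
    proof (induction k)
      case (Suc k)
      then show ?case
        using step[of "n + k"] norm_triangle_ineq[of "Y (Suc (n + k)) - Y (n + k)" "Y (n + k) - Y n"]
        by simp
    qed simp
    then show ?thesis
      using incseqD[OF \<open>incseq y\<close>, of n "n + k"] by (simp add: dist_norm)
  qed
  have "convergent y"
    using \<open>incseq y\<close> y_bounds incseq_convergent by (metis convergent_def)
  then have "Cauchy y" by (rule convergent_Cauchy)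
  have "Cauchy Y"
  proof (rule metric_CauchyI)
    fix e :: real assume "0 < e"
    then obtain M where M: "\<And>m n. M \<le> m \<Longrightarrow> M \<le> n \<Longrightarrow> dist (y m) (y n) < e"
      using metric_CauchyD[OF \<open>Cauchy y\<close>] by blast
    have le: "dist (Y m) (Y n) < e" if "M \<le> n" "n \<le> m" for m n
      using dist_Y[of n "m - n"] M[of m n] that by simp
    have "dist (Y m) (Y n) < e" if "M \<le> m" "M \<le> n" for m n
      using le[of n m] le[of m n] that by (cases "n \<le> m") (auto simp: dist_commute)
    then show "\<exists>M. \<forall>m\<ge>M. \<forall>n\<ge>M. dist (Y m) (Y n) < e" by blast
  qed
  then have "convergent Y" by (rule Cauchy_convergent)
  then obtain Z where Z: "Y \<longlonglongrightarrow> Z" unfolding convergent_def ..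
  note [tendsto_intros] = comp.tendsto
  have "(\<lambda>n. Y (Suc n)) \<longlonglongrightarrow> (1/2) *\<^sub>R (X + (Z o\<^sub>L Z))"
    unfolding Y_Suc by (intro tendsto_intros Z)
  then have Z_eq: "Z = (1/2) *\<^sub>R (X + (Z o\<^sub>L Z))"
    using LIMSEQ_Suc[OF Z] LIMSEQ_unique by blast
  have "2 *\<^sub>R Z = X + (Z o\<^sub>L Z)"
    by (subst Z_eq) simp
  then have ZZ: "2 *\<^sub>R Z a = X a + Z (Z a)" for a
    by (metis blinfun.add_left blinfun.scaleR_left blinfun_apply_blinfun_compose)
  define P where "P = id_blinfun - Z"
  have P: "P a = a - Z a" for a by (simp add: P_def blinfun.diff_left)
  show ?thesis
  proof (rule that)
    show "P (P a) = a - X a" for a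
      using ZZ[of a] by (simp add: P blinfun.diff_right scaleR_2 algebra_simps)
    have Y_sym: "inner (Y n a) b = inner a (Y n b)" for n a b
      by (induction n arbitrary: a b)
        (simp_all add: Y_0 Y_Suc blinfun.scaleR_left blinfun.add_left inner_add sym)
    have "inner (Z a) b = inner a (Z b)" for a b
    proof (rule LIMSEQ_unique)
      show "(\<lambda>n. inner (Y n a) b) \<longlonglongrightarrow> inner (Z a) b"
        by (intro tendsto_intros Z)
      show "(\<lambda>n. inner (Y n a) b) \<longlonglongrightarrow> inner a (Z b)"
        unfolding Y_sym by (intro tendsto_intros Z)
    qed
    then show "inner (P a) b = inner a (P b)" for a b by (simp add: P inner_diff)
    fix C :: "'a \<Rightarrow>\<^sub>L 'a" assume C: "C o\<^sub>L X = X o\<^sub>L C"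
    \<comment> \<open>Every iterate is built from \<open>X\<close> by sums and products, so
      commutation with \<open>X\<close> is inherited by the iterates and then by their
      limit.\<close>
    have Y_comm: "C o\<^sub>L Y n = Y n o\<^sub>L C" for n
    proof (induction n)
      case (Suc n)
      have "C (Y n a) = Y n (C a)" for a
        using arg_cong[OF Suc, of "\<lambda>F. blinfun_apply F a"] by simp
      then have "C o\<^sub>L (Y n o\<^sub>L Y n) = (Y n o\<^sub>L Y n) o\<^sub>L C"
        by (intro blinfun_eqI) simp
      then show ?case
        by (simp add: Y_Suc C comp.add_left comp.add_right
            comp.scaleR_left comp.scaleR_right)
    qed (simp add: Y_0 comp.zero_left comp.zero_right)
    have "C o\<^sub>L Z = Z o\<^sub>L C"
    proof (rule LIMSEQ_unique)
      show "(\<lambda>n. (C o\<^sub>L Y n)) \<longlonglongrightarrow> (C o\<^sub>L Z)" by (intro tendsto_intros Z)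
      show "(\<lambda>n. (C o\<^sub>L Y n)) \<longlonglongrightarrow> (Z o\<^sub>L C)" unfolding Y_comm by (intro tendsto_intros Z)
    qed
    moreover have "C o\<^sub>L id_blinfun = id_blinfun o\<^sub>L C" by (rule blinfun_eqI) simp
    ultimately show "C o\<^sub>L P = P o\<^sub>L C"
      by (simp add: P_def comp.diff_left comp.diff_right)
  qed
qed

section \<open>Unitary equivalence of \<open>T\<^sup>* T\<close> and \<open>T T\<^sup>*\<close>\<close>

text \<open>The pair \<open>(x, T x)\<close> with \<open>x + T\<^sup>* T x = h\<close>; it is the
  projection of \<open>(h, 0)\<close> onto the graph of \<open>T\<close>. Existence and uniqueness
  are established in the locale below.\<close>

definition resolvent_pair ::
    "('a::complex_hilbert, 'b::complex_hilbert) op \<Rightarrow> 'a \<Rightarrow> 'a \<times> 'b"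
  where "resolvent_pair T h = (THE p. p \<in> T \<and> (snd p, h - fst p) \<in> adj T)"

text \<open>\<open>resolvent T\<close> is \<open>(1 + T\<^sup>* T)\<inverse>\<close>, and \<open>op_resolvent T\<close> is \<open>T (1 + T\<^sup>* T)\<inverse>\<close>.\<close>

definition resolvent :: "('a::complex_hilbert, 'b::complex_hilbert) op \<Rightarrow> 'a \<Rightarrow> 'a"
  where "resolvent T h = fst (resolvent_pair T h)"

definition op_resolvent :: "('a::complex_hilbert, 'b::complex_hilbert) op \<Rightarrow> 'a \<Rightarrow> 'b"
  where "op_resolvent T h = snd (resolvent_pair T h)"

text \<open>With \<open>z = T\<^sup>* T x\<close> the cross term of \<open>x\<close> and
  \<open>z\<close> is the squared norm of \<open>T x\<close>, hence nonnegative. This yields both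
  the uniqueness of solutions of \<open>x + T\<^sup>* T x = h\<close> and the contractivity of the
  resolvent.\<close>

lemma norm_adj_comp_add:
  assumes "(x, u) \<in> T" and "(u, z) \<in> adj T"
  shows "(norm (x + z))\<^sup>2 = (norm x)\<^sup>2 + 2 * (norm u)\<^sup>2 + (norm z)\<^sup>2"
proof -
  have "cinner x z = cinner u u" using adjD[OF assms(2,1)] by simp
  then have "inner x z = (norm u)\<^sup>2"
    by (simp add: inner_eq_Re_cinner cinner_self)
  then show ?thesis
    by (simp add: dot_norm field_simps)
qed

locale injective_closed_operator =
  fixes T :: "('a::complex_hilbert, 'b::complex_hilbert) op"
  assumes lin: "linear_operator T" and closed: "closed T"
    and dom: "dense (Domain T)" and ran: "dense (Range T)"
    and inj: "\<And>x. (x, 0) \<in> T \<Longrightarrow> x = 0"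
begin

lemma lin_adj: "linear_operator (adj T)"
  by (rule linear_operator_adj[OF dom])

text \<open>Makes every fact of the locale available for the adjoint too, where
  \<open>adj_adj\<close> turns the second adjoint back into \<open>T\<close>.\<close>

lemma injective_closed_operator_adj: "injective_closed_operator (adj T)"
  by unfold_locales
    (auto intro: lin_adj closed_adj dense_Domain_adj dense_Range_adj adj_injective
      lin closed dom ran inj)

lemma resolvent_eqI:
  assumes x: "(x, u) \<in> T" "(u, h - x) \<in> adj T"
  shows "resolvent T h = x" and "op_resolvent T h = u"
proof -
  have "resolvent_pair T h = (x, u)"
    unfolding resolvent_pair_def
  proof (rule the_equality)
    fix p assume p: "p \<in> T \<and> (snd p, h - fst p) \<in> adj T"
    obtain y v where p_eq: "p = (y, v)" by (cases p)
    \<comment> \<open>The difference of two solutions solves the equation with right-hand side 0,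
      where the norm identity forces it to vanish.\<close>
    have "(x - y, u - v) \<in> T" "(u - v, (h - x) - (h - y)) \<in> adj T"
      using p x by (auto simp only: p_eq fst_conv snd_conv intro!: linear_operator_diff lin lin_adj)
    from norm_adj_comp_add[OF this]
    have "(norm (x - y))\<^sup>2 + 2 * (norm (u - v))\<^sup>2 + (norm ((h - x) - (h - y)))\<^sup>2 = 0"
      by simp
    then have "norm (x - y) = 0 \<and> norm (u - v) = 0"
      using zero_le_power2[of "norm (x - y)"] zero_le_power2[of "norm (u - v)"]
        zero_le_power2[of "norm ((h - x) - (h - y))"]
      by (smt (verit) power2_less_0 zero_eq_power2)
    then show "p = (x, u)" by (simp add: p_eq)
  qed (use x in simp)
  then show "resolvent T h = x" and "op_resolvent T h = u"
    by (simp_all add: resolvent_def op_resolvent_def)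
qed

lemma op_resolvent: "(resolvent T h, op_resolvent T h) \<in> T"
  and adj_op_resolvent: "(op_resolvent T h, h - resolvent T h) \<in> adj T"
proof -
  \<comment> \<open>Decomposing \<open>(h, 0)\<close> makes \<open>u = y\<close>, so
    \<open>T x\<close> falls into the domain of the adjoint.\<close>
  obtain x u y z where xu: "(x, u) \<in> T" and yz: "(y, z) \<in> adj T" and "h = x + z" "0 = u - y"
    using graph_decomposition[OF lin closed] by blast
  then have "(u, h - x) \<in> adj T" by simp
  then show "(resolvent T h, op_resolvent T h) \<in> T"
    and "(op_resolvent T h, h - resolvent T h) \<in> adj T"
    using xu resolvent_eqI by metis+
qed

lemma resolvent_add: "resolvent T (h + k) = resolvent T h + resolvent T k"
  and op_resolvent_add: "op_resolvent T (h + k) = op_resolvent T h + op_resolvent T k"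
proof -
  have *: "h + k - (resolvent T h + resolvent T k) = (h - resolvent T h) + (k - resolvent T k)"
    by simp
  have "(resolvent T h + resolvent T k, op_resolvent T h + op_resolvent T k) \<in> T"
    "(op_resolvent T h + op_resolvent T k, h + k - (resolvent T h + resolvent T k)) \<in> adj T"
    unfolding * by (intro linear_operator_add lin lin_adj op_resolvent adj_op_resolvent)+
  then show "resolvent T (h + k) = resolvent T h + resolvent T k"
    and "op_resolvent T (h + k) = op_resolvent T h + op_resolvent T k"
    by (rule resolvent_eqI)+
qed

lemma resolvent_scaleC: "resolvent T (c *\<^sub>C h) = c *\<^sub>C resolvent T h"
  and op_resolvent_scaleC: "op_resolvent T (c *\<^sub>C h) = c *\<^sub>C op_resolvent T h"
proof -
  have "(c *\<^sub>C resolvent T h, c *\<^sub>C op_resolvent T h) \<in> T"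
    "(c *\<^sub>C op_resolvent T h, c *\<^sub>C h - c *\<^sub>C resolvent T h) \<in> adj T"
    unfolding scaleC_diff_right[symmetric]
    by (intro linear_operator_scaleC lin lin_adj op_resolvent adj_op_resolvent)+
  then show "resolvent T (c *\<^sub>C h) = c *\<^sub>C resolvent T h"
    and "op_resolvent T (c *\<^sub>C h) = c *\<^sub>C op_resolvent T h"
    by (rule resolvent_eqI)+
qed

lemma norm_resolvent: "norm (resolvent T h) \<le> norm h"
proof -
  have "(norm (resolvent T h))\<^sup>2 \<le> (norm h)\<^sup>2"
    using norm_adj_comp_add[OF op_resolvent adj_op_resolvent, of h] by simp
  then show ?thesis by (rule power2_le_imp_le) simp
qed

lemma bounded_linear_resolvent: "bounded_linear (resolvent T)"
  by (rule bounded_linear_intro[where K = 1])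
    (simp_all add: resolvent_add resolvent_scaleC scaleR_scaleC norm_resolvent)

text \<open>With \<open>R = resolvent T\<close>, \<open>Z = op_resolvent T\<close> and the symmetry
  of \<open>R\<close> proved next, this is the weak form of
  \<open>Z\<^sup>* Z = R - R\<^sup>2\<close>.\<close>

lemma cinner_op_resolvent:
  "cinner (op_resolvent T h) (op_resolvent T k) = cinner (resolvent T h) (k - resolvent T k)"
  by (rule adjD[OF adj_op_resolvent op_resolvent])

text \<open>The inner product of \<open>op_resolvent T h\<close> and \<open>op_resolvent T k\<close>
  is evaluated twice, moving \<open>T\<close> off either factor.\<close>

lemma cinner_resolvent: "cinner (resolvent T h) k = cinner h (resolvent T k)"
proof -
  have "cinner (resolvent T h) (k - resolvent T k) = cinner (h - resolvent T h) (resolvent T k)"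
    using cinner_op_resolvent[of h k] adjD'[OF adj_op_resolvent op_resolvent, of h k] by simp
  then show ?thesis by (simp add: cinner_simps)
qed

text \<open>The vector \<open>y = T R\<^sup>2 h\<close>, with \<open>R = resolvent T\<close>,
  satisfies \<open>T\<^sup>* y = R h - R\<^sup>2 h\<close>. Applying \<open>T\<close> shows that
  \<open>y\<close> solves \<open>y + T T\<^sup>* y = T R h\<close>.\<close>

lemma resolvent_op_resolvent:
  "resolvent (adj T) (op_resolvent T h) = op_resolvent T (resolvent T h)"
proof -
  interpret T': injective_closed_operator "adj T" by (rule injective_closed_operator_adj)
  let ?x = "resolvent T h"
  have "(?x - resolvent T ?x, op_resolvent T h - op_resolvent T ?x) \<in> adj (adj T)"
    unfolding adj_adj[OF lin closed] by (intro linear_operator_diff lin op_resolvent)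
  from T'.resolvent_eqI(1)[OF adj_op_resolvent this] show ?thesis .
qed

text \<open>The norm identity is applied to the same equation
  \<open>y + T T\<^sup>* y = T R h\<close>, whose middle term carries \<open>T\<^sup>* y\<close>.
  The bound makes \<open>1 - (R - R\<^sup>2)\<close> a contraction, as the square root construction
  requires.\<close>

lemma norm_resolvent_diff:
  "norm (resolvent T h - resolvent T (resolvent T h)) \<le> norm (op_resolvent T h)"
proof -
  let ?x = "resolvent T h"
  have "(?x - resolvent T ?x, op_resolvent T h - op_resolvent T ?x) \<in> adj (adj T)"
    unfolding adj_adj[OF lin closed] by (intro linear_operator_diff lin op_resolvent)
  from norm_adj_comp_add[OF adj_op_resolvent this]
  have "2 * (norm (?x - resolvent T ?x))\<^sup>2 \<le> (norm (op_resolvent T h))\<^sup>2"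
    by simp
  then have "(norm (?x - resolvent T ?x))\<^sup>2 \<le> (norm (op_resolvent T h))\<^sup>2"
    using zero_le_power2[of "norm (?x - resolvent T ?x)"] by linarith
  then show ?thesis by (rule power2_le_imp_le) simp
qed

lemma op_resolvent_eq_0: "op_resolvent T h = 0 \<Longrightarrow> h = 0"
  using op_resolvent[of h] adj_op_resolvent[of h] inj linear_operator_0[OF lin_adj]
    linear_operator_unique[OF lin_adj] by fastforce

text \<open>The adjoint of \<open>op_resolvent T\<close> acts as
  \<open>op_resolvent (adj T)\<close>, which is injective. A vector \<open>g\<close> orthogonal to
  the range is therefore tested against the image of \<open>?w\<close>, the value of that adjoint at
  \<open>g\<close>.\<close>

lemma dense_range_op_resolvent: "dense (range (op_resolvent T))"
proof (rule dense_complex_subspace)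
  interpret T': injective_closed_operator "adj T" by (rule injective_closed_operator_adj)
  fix g assume g: "\<And>s. s \<in> range (op_resolvent T) \<Longrightarrow> cinner s g = 0"
  let ?y = "resolvent (adj T) g" and ?w = "op_resolvent (adj T) g"
  have w: "(?w, g - ?y) \<in> T"
    using T'.adj_op_resolvent[of g] by (simp add: adj_adj lin closed)
  let ?u = "op_resolvent T ?w"
  have "cinner ?u ?y = cinner (resolvent T ?w) ?w"
    by (rule adjD[OF T'.op_resolvent op_resolvent])
  moreover have "cinner ?u (g - ?y) = cinner (?w - resolvent T ?w) ?w"
    by (rule adjD'[OF adj_op_resolvent w])
  ultimately have "cinner ?u g = cinner ?w ?w"
    by (simp add: cinner_simps)
  then have "?w = 0" using g[of ?u] by simp
  then show "g = 0" by (rule T'.op_resolvent_eq_0)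
next
  fix x y c assume "x \<in> range (op_resolvent T)" "y \<in> range (op_resolvent T)"
  then show "x + y \<in> range (op_resolvent T)" "c *\<^sub>C x \<in> range (op_resolvent T)"
    by (auto simp flip: op_resolvent_add op_resolvent_scaleC)
qed auto

text \<open>
  The unitary factor \<open>W\<close> of the polar decomposition of the bounded injective operator
  \<open>Z = T (1 + T\<^sup>* T)\<inverse>\<close> intertwines the resolvents, because \<open>Z\<^sup>* Z = R - R\<^sup>2\<close> is a function of
  \<open>R = (1 + T\<^sup>* T)\<inverse>\<close> and \<open>Z R = (1 + T T\<^sup>*)\<inverse> Z\<close>.
\<close>

lemma unitary_intertwiner:
  obtains W :: "'a \<Rightarrow> 'b" where "unitary W"
    and "\<And>h. W (resolvent T h) = resolvent (adj T) (W h)"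
proof -
  interpret T': injective_closed_operator "adj T" by (rule injective_closed_operator_adj)
  define R where "R = Blinfun (resolvent T)"
  have R: "R h = resolvent T h" for h
    by (simp add: R_def bounded_linear_Blinfun_apply bounded_linear_resolvent)
  have inner_R: "inner (R a) b = inner a (R b)" for a b
    by (simp add: R inner_eq_Re_cinner cinner_resolvent)
  \<comment> \<open>Chosen so that \<open>1 - X = R - R\<^sup>2\<close>; the square root
    \<open>P\<close> of \<open>1 - X\<close> then serves as the modulus of \<open>Z\<close>.\<close>
  define X where "X = id_blinfun - R + (R o\<^sub>L R)"
  have X: "X h = h - (R h - R (R h))" for h
    by (simp add: X_def blinfun.add_left blinfun.diff_left)
  have inner_Q: "inner a (R b - R (R b)) = inner (op_resolvent T a) (op_resolvent T b)" for a b
    by (simp add: inner_eq_Re_cinner cinner_op_resolvent R cinner_diff_right cinner_resolvent)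
  have "norm X \<le> 1"
  proof (rule norm_blinfun_bound)
    fix h
    let ?q = "R h - R (R h)"
    \<comment> \<open>Since \<open>X h = h - ?q\<close>, contractivity amounts to the squared norm
      of \<open>?q\<close> being at most twice its inner product with \<open>h\<close>, which is the
      squared norm of \<open>Z h\<close>.\<close>
    have "(norm (X h))\<^sup>2 = (norm h)\<^sup>2 - 2 * inner h ?q + (norm ?q)\<^sup>2"
      unfolding X power2_norm_eq_inner
      by (simp add: inner_diff_left[of h ?q] inner_diff_right[of _ h ?q] inner_commute[of ?q h])
    also have "\<dots> \<le> (norm h)\<^sup>2"
    proof -
      have "(norm ?q)\<^sup>2 \<le> (norm (op_resolvent T h))\<^sup>2"
        unfolding R by (intro power_mono norm_resolvent_diff norm_ge_zero)
      moreover have "inner h ?q = (norm (op_resolvent T h))\<^sup>2"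
        by (simp add: inner_Q power2_norm_eq_inner)
      ultimately show ?thesis
        using zero_le_power2[of "norm (op_resolvent T h)"] by linarith
    qed
    finally show "norm (X h) \<le> 1 * norm h"
      using power2_le_imp_le[OF _ norm_ge_zero] by simp
  qed simp
  moreover have "inner (X a) b = inner a (X b)" for a b
    by (simp add: X inner_diff_left inner_diff_right inner_R)
  ultimately obtain P :: "'a \<Rightarrow>\<^sub>L 'a" where PP: "\<And>a. P (P a) = a - X a"
    and inner_P: "\<And>a b. inner (P a) b = inner a (P b)"
    and P_comm: "\<And>C. C o\<^sub>L X = X o\<^sub>L C \<Longrightarrow> C o\<^sub>L P = P o\<^sub>L C"
    by (rule bounded_operator_sqrt) (rule that)
  have "R o\<^sub>L X = X o\<^sub>L R"
    by (rule blinfun_eqI) (simp add: X blinfun.diff_right)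
  then have PR: "P (R h) = R (P h)" for h
    by (metis P_comm blinfun_apply_blinfun_compose)
  have P_scaleC: "P (c *\<^sub>C h) = c *\<^sub>C P h" for c h
  proof -
    \<comment> \<open>The square root was built from real-linear operators. Complex linearity of
      \<open>P\<close> follows because multiplication by \<open>c\<close> commutes with
      \<open>X\<close>.\<close>
    define C :: "'a \<Rightarrow>\<^sub>L 'a" where "C = Blinfun (\<lambda>h. c *\<^sub>C h)"
    have C: "C h = c *\<^sub>C h" for h
      by (simp add: C_def bounded_linear_Blinfun_apply bounded_linear_scaleC)
    have "C o\<^sub>L X = X o\<^sub>L C"
      by (rule blinfun_eqI) (simp add: X C R resolvent_scaleC scaleC_diff_right)
    then show ?thesis by (metis C P_comm blinfun_apply_blinfun_compose)
  qed
  have norm_P: "norm (P h) = norm (op_resolvent T h)" for h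
  proof -
    have "inner (P h) (P h) = inner h (R h - R (R h))"
      by (simp add: inner_P PP X)
    then show ?thesis by (simp add: norm_eq_sqrt_inner inner_Q)
  qed
  \<comment> \<open>The partial isometry of the polar decomposition: it sends \<open>P h\<close> to
    \<open>Z h\<close>, and \<open>norm_P\<close> makes it well defined.\<close>
  define F where "F = range (\<lambda>h. (P h, op_resolvent T h))"
  have F_mem: "(P h, op_resolvent T h) \<in> F" for h by (simp add: F_def)
  have F_0: "u = 0" if 0: "(0, u) \<in> F" for u
  proof -
    obtain h where "P h = 0" "u = op_resolvent T h" using 0 by (auto simp: F_def)
    then show ?thesis using norm_P[of h] by simp
  qed
  have F_add: "(x + y, u + v) \<in> F" if "(x, u) \<in> F" "(y, v) \<in> F" for x y u v
    using that by (auto simp: F_def simp flip: op_resolvent_add blinfun.add_right)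
  have F_scaleC: "(c *\<^sub>C x, c *\<^sub>C u) \<in> F" if "(x, u) \<in> F" for x u c
    using that by (auto simp: F_def simp flip: op_resolvent_scaleC P_scaleC)
  have "linear_operator F"
    unfolding linear_operator_def
  proof (intro conjI allI impI F_add F_scaleC)
    show "single_valued F"
    proof (rule single_valuedI)
      fix x u v assume "(x, u) \<in> F" "(x, v) \<in> F"
      then have "(x + (- 1) *\<^sub>C x, u + (- 1) *\<^sub>C v) \<in> F"
        by (intro F_add F_scaleC)
      then show "u = v" using F_0[of "u - v"] by simp
    qed
    show "(0, 0) \<in> F"
      using F_mem[of 0] op_resolvent_scaleC[of 0 0] by simp
  qed
  moreover have "isometric_op F"
    by (auto simp: isometric_op_def F_def norm_P)
  moreover have "dense (Domain F)"
  proof (rule linear_operator_domain_dense[OF \<open>linear_operator F\<close>])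
    fix k assume k: "\<And>x u. (x, u) \<in> F \<Longrightarrow> cinner x k = 0"
    \<comment> \<open>Orthogonality to the range of \<open>P\<close> is tested at
      \<open>P (P k)\<close>; symmetry turns this into the squared norm of
      \<open>P k\<close>.\<close>
    have "inner (P (P k)) k = 0"
      using k[OF F_mem[of "P k"]] by (simp add: inner_eq_Re_cinner)
    then have "P k = 0" by (simp add: inner_P[of "P k"])
    then have "op_resolvent T k = 0" using norm_P[of k] by simp
    then show "k = 0" by (rule op_resolvent_eq_0)
  qed
  moreover have "Range F = range (op_resolvent T)" by (auto simp: F_def)
  ultimately obtain W where W: "unitary W" and WF: "\<And>x u. (x, u) \<in> F \<Longrightarrow> W x = u"
    using unitary_extension_exists dense_range_op_resolvent by metis
  have WP: "W (P k) = op_resolvent T k" for k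
    by (rule WF[OF F_mem])
  have "W (resolvent T h) = resolvent (adj T) (W h)" for h
  proof (rule dense_induct[where x = h, OF \<open>dense (Domain F)\<close>])
    show "closed {h. W (resolvent T h) = resolvent (adj T) (W h)}"
      using bounded_linear_compose[OF unitary_bounded_linear[OF W] bounded_linear_resolvent]
        bounded_linear_compose[OF T'.bounded_linear_resolvent unitary_bounded_linear[OF W]]
      by (intro closed_Collect_eq linear_continuous_on)
    fix h assume "h \<in> Domain F"
    then obtain k where h: "h = P k" by (auto simp: F_def)
    \<comment> \<open>Moving \<open>R\<close> inside \<open>P\<close> lets \<open>W\<close> turn
      \<open>P R\<close> into \<open>Z R\<close>, where the intertwining relation for
      \<open>Z\<close> takes over.\<close>
    have "W (resolvent T h) = W (P (resolvent T k))" using PR[of k] by (simp add: h R)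
    then show "W (resolvent T h) = resolvent (adj T) (W h)"
      by (simp add: h WP resolvent_op_resolvent)
  qed
  with W show ?thesis by (rule that)
qed

text \<open>Encodes the unbounded operator, domain included, by its everywhere defined resolvent; an
  intertwiner of resolvents thus intertwines the operators without separate domain
  questions.\<close>

lemma adj_comp_iff_resolvent: "(x, z) \<in> adj T \<circ>\<^sub>o T \<longleftrightarrow> resolvent T (x + z) = x"
  using resolvent_eqI(1)[of x _ "x + z"] op_resolvent[of "x + z"] adj_op_resolvent[of "x + z"]
  by auto

lemma unitary_equivalence_comp_adj:
  obtains W :: "'a \<Rightarrow> 'b" where "unitary W"
    and "\<And>x z. (W x, W z) \<in> T \<circ>\<^sub>o adj T \<longleftrightarrow> (x, z) \<in> adj T \<circ>\<^sub>o T"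
proof -
  interpret T': injective_closed_operator "adj T" by (rule injective_closed_operator_adj)
  obtain W where W: "unitary W" and WR: "\<And>h. W (resolvent T h) = resolvent (adj T) (W h)"
    using unitary_intertwiner by blast
  show ?thesis
  proof (rule that[OF W])
    fix x z
    have "(W x, W z) \<in> T \<circ>\<^sub>o adj T \<longleftrightarrow> W (resolvent T (x + z)) = W x"
      using T'.adj_comp_iff_resolvent[of "W x" "W z"]
      by (simp add: adj_adj lin closed WR unitary_add[OF W])
    then show "(W x, W z) \<in> T \<circ>\<^sub>o adj T \<longleftrightarrow> (x, z) \<in> adj T \<circ>\<^sub>o T"
      by (simp add: adj_comp_iff_resolvent unitary_eq_iff[OF W])
  qed
qed

end

section \<open>The spaces \<open>\<D>(T)\<close> and \<open>\<R>(S)\<close>\<close>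

lemma dense_mono: "dense S \<Longrightarrow> S \<subseteq> S' \<Longrightarrow> dense S'"
  using closure_mono[of S S'] by (auto simp: dense_def)

lemma unitary_eqI:
  assumes "unitary U" "unitary V" "dense S" and "\<And>x. x \<in> S \<Longrightarrow> U x = V x"
  shows "U = V"
proof
  fix x
  have "closed {x. U x = V x}"
    by (intro closed_Collect_eq unitary_continuous assms)
  with \<open>dense S\<close> show "U x = V x"
    by (rule dense_induct) (rule assms)
qed

lemma unitary_extensions_eq_singleton:
  assumes U: "unitary U" and dense: "dense (Domain F)" and ext: "\<And>x u. (x, u) \<in> F \<Longrightarrow> u = U x"
  shows "unitary_extensions F = {U}"
proof -
  have "V = U" if V: "V \<in> unitary_extensions F" for V
  proof (rule unitary_eqI[OF _ U dense])
    show "unitary V" using V by (simp add: unitary_extensions_def)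
    fix x assume "x \<in> Domain F"
    then obtain u where "(x, u) \<in> F" by blast
    moreover from this have "u = V x"
      using V by (auto simp: unitary_extensions_def graph_of_def)
    ultimately show "V x = U x" using ext by metis
  qed
  moreover have "U \<in> unitary_extensions F"
    using U ext by (auto simp: unitary_extensions_def graph_of_def)
  ultimately show ?thesis by blast
qed

lemma D_space_unitary:
  fixes T :: "('h::complex_hilbert, 'g::complex_hilbert) op" and \<iota> :: "'h \<Rightarrow> 'd::complex_hilbert"
  assumes T: "linear_operator T" and ran: "dense (Range T)" and D: "is_D_space T \<iota>"
  obtains V where "unitary V" and "\<And>x u. (x, u) \<in> T \<Longrightarrow> V u = \<iota> x"
proof -
  have \<iota>_add: "\<iota> (x + y) = \<iota> x + \<iota> y" and \<iota>_scale: "\<iota> (c *\<^sub>C x) = c *\<^sub>C \<iota> x"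
    if "(x, u) \<in> T" "(y, v) \<in> T" for x y u v c
    using D DomainI[OF that(1)] DomainI[OF that(2)]
    by (simp_all add: is_D_space_def clinear_on_def)
  have iso: "norm (\<iota> x) = norm u" if "(x, u) \<in> T" for x u
  proof -
    have "cinner (\<iota> x) (\<iota> x) = cinner u u"
      using D that unfolding is_D_space_def by blast
    then show ?thesis by (simp add: norm_eq_sqrt_inner inner_eq_Re_cinner)
  qed
  define F where "F = {(u, \<iota> x) |x u. (x, u) \<in> T}"
  have F_iff: "(u, a) \<in> F \<longleftrightarrow> (\<exists>x. (x, u) \<in> T \<and> a = \<iota> x)" for u a
    by (auto simp: F_def)
  have "linear_operator F"
    unfolding linear_operator_def
  proof (intro conjI allI impI)
    show "single_valued F"
    proof (rule single_valuedI)
      fix u a b assume "(u, a) \<in> F" "(u, b) \<in> F"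
      then obtain x y where xy: "(x, u) \<in> T" "(y, u) \<in> T" and ab: "a = \<iota> x" "b = \<iota> y"
        unfolding F_def by blast
      have m: "(- y, - u) \<in> T" by (rule linear_operator_minus[OF T xy(2)])
      \<comment> \<open>Two preimages of \<open>u\<close> differ by a vector that \<open>T\<close>
        sends to 0; its image in the completion has norm 0, so the two values agree.\<close>
      have "\<iota> (x + - y) = a - b"
        using \<iota>_add[OF xy(1) m] \<iota>_scale[OF xy(2) xy(2), of "- 1"] by (simp add: ab)
      moreover have "norm (\<iota> (x + - y)) = norm (u + - u)"
        by (intro iso linear_operator_add T xy m)
      ultimately show "a = b" by simp
    qed
    show "(0, 0) \<in> F"
      unfolding F_iff using linear_operator_0[OF T] iso[of 0 0] by (intro exI[of _ 0]) simp
  next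
    fix u a v b assume "(u, a) \<in> F" "(v, b) \<in> F"
    then obtain x y where "(x, u) \<in> T" "(y, v) \<in> T" "a = \<iota> x" "b = \<iota> y"
      unfolding F_def by blast
    then show "(u + v, a + b) \<in> F"
      unfolding F_iff by (intro exI[of _ "x + y"]) (simp add: linear_operator_add[OF T] \<iota>_add)
  next
    fix c u a assume "(u, a) \<in> F"
    then obtain x where "(x, u) \<in> T" "a = \<iota> x"
      unfolding F_def by blast
    then show "(c *\<^sub>C u, c *\<^sub>C a) \<in> F"
      unfolding F_iff by (intro exI[of _ "c *\<^sub>C x"]) (simp add: linear_operator_scaleC[OF T] \<iota>_scale)
  qed
  moreover have "isometric_op F"
    using iso by (auto simp: isometric_op_def F_def)
  moreover have "Domain F = Range T" "Range F = \<iota> ` Domain T"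
    by (auto simp: F_def)
  moreover have "dense (\<iota> ` Domain T)"
    using D by (simp add: is_D_space_def)
  ultimately obtain V where V: "unitary V" "\<And>u a. (u, a) \<in> F \<Longrightarrow> V u = a"
    using unitary_extension_exists[of F] ran by metis
  show ?thesis
  proof (rule that[OF V(1)])
    fix x u assume "(x, u) \<in> T"
    then show "V u = \<iota> x" by (intro V(2)) (auto simp: F_def)
  qed
qed

text \<open>For injective \<open>S\<close> the orthogonality condition in \<open>is_R_space\<close>
  always holds, which makes the completion of the range a space of type \<open>is_D_space\<close>
  for the inverse of \<open>S\<close>.\<close>

lemma R_space_unitary:
  fixes S :: "('g::complex_hilbert, 'h::complex_hilbert) op" and \<iota> :: "'h \<Rightarrow> 'r::complex_hilbert"
  assumes S: "linear_operator S" and inj: "\<And>x. (x, 0) \<in> S \<Longrightarrow> x = 0"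
    and dom: "dense (Domain S)" and R: "is_R_space S \<iota>"
  obtains U where "unitary U" and "\<And>y z. (y, z) \<in> S \<Longrightarrow> U y = \<iota> z"
proof -
  have "null_space S \<subseteq> {0}" using inj by (auto simp: null_space_def)
  then have "is_D_space (S\<inverse>) \<iota>"
    using R unfolding is_R_space_def is_D_space_def by fastforce
  moreover have "linear_operator (S\<inverse>)" "dense (Range (S\<inverse>))"
    using linear_operator_converse[OF S inj] dom by simp_all
  ultimately obtain U where "unitary U" "\<And>z y. (z, y) \<in> S\<inverse> \<Longrightarrow> U y = \<iota> z"
    using D_space_unitary by metis
  then show ?thesis using that by blast
qed

text \<open>Cauchy-Schwarz gives one inequality; elements of \<open>S\<close> close to
  \<open>w\<close> nearly attain the other. In \<open>ennreal\<close> the empty supremum is 0, which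
  covers the zero space.\<close>

lemma norm_eq_SUP_dense:
  fixes w :: "'a::complex_hilbert"
  assumes "dense S"
  shows "ennreal (norm w) = (SUP u \<in> S - {0}. ennreal (cmod (cinner w u) / norm u))"
proof (rule antisym)
  show "(SUP u \<in> S - {0}. ennreal (cmod (cinner w u) / norm u)) \<le> ennreal (norm w)"
    by (intro SUP_least ennreal_leI) (simp add: divide_le_eq cmod_cinner_le)
  show "ennreal (norm w) \<le> (SUP u \<in> S - {0}. ennreal (cmod (cinner w u) / norm u))"
  proof (cases "w = 0")
    case False
    show ?thesis
    proof (rule ennreal_le_epsilon)
      fix e :: real assume "0 < e"
      \<comment> \<open>Half of \<open>e\<close> leaves room for two errors of size
        \<open>d\<close>: from \<open>norm w\<close> to \<open>norm u\<close> and from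
        \<open>norm u\<close> to the quotient. Also \<open>d < norm w\<close> keeps \<open>u\<close>
        nonzero.\<close>
      define d where "d = min (e / 2) (norm w / 2)"
      have d: "0 < d" "2 * d \<le> e" "d < norm w"
        using \<open>0 < e\<close> False by (auto simp: d_def min_def)
      have "w \<in> closure S" using assms by (simp add: dense_def)
      then obtain u where u: "u \<in> S" "dist u w < d"
        using d(1) by (auto simp: closure_approachable)
      then have "norm (w - u) < d" by (simp add: dist_norm norm_minus_commute)
      then have "u \<noteq> 0" and wu: "norm w - d \<le> norm u"
        using d(3) norm_triangle_ineq2[of w u] by auto
      have "norm u * norm u = cmod (cinner u u)"
        by (simp add: cinner_self power2_eq_square norm_mult)
      also have "\<dots> \<le> cmod (cinner w u) + cmod (cinner (w - u) u)"
        using norm_triangle_ineq4[of "cinner w u" "cinner (w - u) u"] by (simp add: cinner_diff_left)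
      also have "\<dots> \<le> cmod (cinner w u) + d * norm u"
        using cmod_cinner_le[of "w - u" u] \<open>norm (w - u) < d\<close>
        by (smt (verit) mult_right_mono norm_ge_zero)
      finally have "norm u \<le> cmod (cinner w u) / norm u + d"
        using \<open>u \<noteq> 0\<close> by (simp add: field_simps)
      then have "norm w \<le> cmod (cinner w u) / norm u + e"
        using wu d(2) by linarith
      then have "ennreal (norm w) \<le> ennreal (cmod (cinner w u) / norm u) + ennreal e"
        using \<open>0 < e\<close> by (simp add: ennreal_leI flip: ennreal_plus)
      also have "\<dots> \<le> (SUP u \<in> S - {0}. ennreal (cmod (cinner w u) / norm u)) + ennreal e"
        using u \<open>u \<noteq> 0\<close> by (intro add_right_mono SUP_upper) auto
      finally show "ennreal (norm w)
        \<le> (SUP u \<in> S - {0}. ennreal (cmod (cinner w u) / norm u)) + ennreal e" .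
    qed
  qed simp
qed

section \<open>The conjugate dual space\<close>

lemma polarization:
  "(\<Sum>k<4. \<i> ^ k * complex_of_real ((norm (a + (\<i> ^ k) *\<^sub>C b))\<^sup>2)) / 4 = cinner a b"
  unfolding cinner_self[symmetric]
  by (simp add: eval_nat_numeral cinner_simps algebra_simps)

text \<open>The map is \<open>A\<close> followed by the Riesz identification; the inner product of
  the dual is recovered from its norm by polarization.\<close>

lemma unitary_onto_conj_dual_cinner:
  assumes A: "unitary A"
  shows "unitary_onto_conj_dual (\<lambda>\<alpha> x. cinner (A \<alpha>) x)"
  unfolding unitary_onto_conj_dual_def
proof (intro conjI allI)
  let ?\<Theta> = "\<lambda>\<alpha> x. cinner (A \<alpha>) x"
  show "bij_betw ?\<Theta> UNIV conj_dual"
    unfolding bij_betw_def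
  proof
    show "inj ?\<Theta>"
    proof (rule injI)
      fix \<alpha> \<beta> assume "?\<Theta> \<alpha> = ?\<Theta> \<beta>"
      then have "cinner (A \<alpha> - A \<beta>) (A \<alpha> - A \<beta>) = 0"
        by (simp only: cinner_diff_left) (metis right_minus_eq)
      then show "\<alpha> = \<beta>" by (simp add: unitary_eq_iff[OF A])
    qed
    show "range ?\<Theta> = conj_dual"
    proof
      show "range ?\<Theta> \<subseteq> conj_dual"
        by (auto simp: conj_dual_def cinner_add_right cinner_scaleC_right intro!: continuous_intros)
      show "conj_dual \<subseteq> range ?\<Theta>"
      proof
        fix f :: "'b \<Rightarrow> complex" assume "f \<in> conj_dual"
        then obtain a where "\<And>x. f x = cinner a x" using riesz_representation by blast
        then have "f = ?\<Theta> (inv A a)" using A by auto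
        then show "f \<in> range ?\<Theta>" by blast
      qed
    qed
  qed
  fix \<alpha> \<beta> c
  show "?\<Theta> (\<alpha> + \<beta>) = (\<lambda>x. ?\<Theta> \<alpha> x + ?\<Theta> \<beta> x)"
    by (simp add: unitary_add[OF A] cinner_add_left)
  show "?\<Theta> (c *\<^sub>C \<alpha>) = (\<lambda>x. c * ?\<Theta> \<alpha> x)"
    by (simp add: unitary_scaleC[OF A] cinner_scaleC_left)
  show "onorm (?\<Theta> \<alpha>) = norm \<alpha>"
    by (simp add: onorm_cinner unitary_norm[OF A])
  have *: "(\<lambda>x. ?\<Theta> \<alpha> x + \<i> ^ k * ?\<Theta> \<beta> x) = cinner (A (\<alpha> + \<i> ^ k *\<^sub>C \<beta>))" for k
    by (simp add: fun_eq_iff unitary_add[OF A] unitary_scaleC[OF A] cinner_simps)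
  show "dual_inner (?\<Theta> \<alpha>) (?\<Theta> \<beta>) = cinner \<alpha> \<beta>"
    unfolding dual_inner_def * onorm_cinner unitary_norm[OF A] by (rule polarization)
qed

text \<open>The embeddings are described as \<open>i = T\<inverse> V\<inverse>\<close> and
  \<open>j = T\<^sup>* U\<inverse>\<close>, so that all later computations take place in the middle
  space of \<open>T\<close> and its adjoint.\<close>

locale operator_spaces = injective_closed_operator T
  for T :: "('h::complex_hilbert, 'g::complex_hilbert) op" +
  fixes V :: "'g \<Rightarrow> 'd::complex_hilbert" and U :: "'g \<Rightarrow> 'r::complex_hilbert"
    and i :: "('d, 'h) op" and j :: "('r, 'h) op"
  assumes V: "unitary V" and U: "unitary U"
    and i_iff: "(a, x) \<in> i \<longleftrightarrow> (x, inv V a) \<in> T"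
    and j_iff: "(b, z) \<in> j \<longleftrightarrow> (inv U b, z) \<in> adj T"
begin

lemmas T_unique = linear_operator_unique[OF lin]

lemma adj_unique: "(y, z) \<in> adj T \<Longrightarrow> (y', z) \<in> adj T \<Longrightarrow> y = y'"
  using linear_operator_diff[OF lin_adj] adj_injective[OF ran, of "y - y'"] by fastforce

lemma inv_V_V [simp]: "inv V (V u) = u" and V_inv_V [simp]: "V (inv V a) = a"
  and inv_U_U [simp]: "inv U (U u) = u" and U_inv_U [simp]: "U (inv U b) = b"
  by (simp_all add: U V)

text \<open>As \<open>V\<close> is unitary, the adjoint of \<open>T\<inverse> V\<inverse>\<close> is
  \<open>V\<close> after the inverse of \<open>T\<^sup>*\<close>.\<close>

lemma adj_i_iff: "(x, a) \<in> adj i \<longleftrightarrow> (inv V a, x) \<in> adj T"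
proof -
  have *: "cinner b a = cinner (inv V b) (inv V a)" for b
    by (simp add: unitary_cinner unitary_inv V)
  have "(x, a) \<in> adj i \<longleftrightarrow> (\<forall>b y. (y, inv V b) \<in> T \<longrightarrow> cinner y x = cinner (inv V b) (inv V a))"
    by (auto simp: adj_def i_iff *)
  also have "\<dots> \<longleftrightarrow> (\<forall>y u. (y, u) \<in> T \<longrightarrow> cinner y x = cinner u (inv V a))"
    by (metis inv_V_V)
  also have "\<dots> \<longleftrightarrow> (inv V a, x) \<in> adj T"
    by (fastforce simp: adj_def)
  finally show ?thesis .
qed

text \<open>The same computation for \<open>U\<close> after the inverse of \<open>T\<^sup>*\<close>;
  here \<open>adj_adj\<close> returns \<open>T\<close> itself, so the adjoint is
  \<open>T\<inverse> U\<inverse>\<close>.\<close>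

lemma adj_j_inverse_iff: "(b, w) \<in> adj (j\<inverse>) \<longleftrightarrow> (w, inv U b) \<in> T"
proof -
  have *: "cinner c b = cinner (inv U c) (inv U b)" for c
    by (simp add: unitary_cinner unitary_inv U)
  have "(b, w) \<in> adj (j\<inverse>) \<longleftrightarrow>
      (\<forall>c z. (inv U c, z) \<in> adj T \<longrightarrow> cinner (inv U c) (inv U b) = cinner z w)"
    by (auto simp: adj_def[of "j\<inverse>"] j_iff *)
  also have "\<dots> \<longleftrightarrow> (\<forall>y z. (y, z) \<in> adj T \<longrightarrow> cinner y (inv U b) = cinner z w)"
    by (metis inv_U_U)
  also have "\<dots> \<longleftrightarrow> (w, inv U b) \<in> adj (adj T)"
    by (fastforce simp: adj_def[of "adj T"])
  finally show ?thesis by (simp add: adj_adj lin closed)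
qed

lemma closed_embedding_i: "closed_embedding i"
  unfolding closed_embedding_def
proof (intro conjI)
  show "linear_operator i"
    unfolding linear_operator_def
  proof (intro conjI allI impI)
    show "single_valued i"
    proof (rule single_valuedI)
      fix a x y assume "(a, x) \<in> i" "(a, y) \<in> i"
      then have "(x - y, 0) \<in> T"
        using linear_operator_diff[OF lin] by (fastforce simp: i_iff)
      then show "x = y" using inj[of "x - y"] by simp
    qed
  qed (use unitaryD[OF unitary_inv[OF V]] unitary_0[OF unitary_inv[OF V]] in
      \<open>auto simp: i_iff intro: linear_operator_0 linear_operator_add linear_operator_scaleC lin\<close>)
  show "injective_op i"
    unfolding injective_op_def
    by (rule single_valuedI) (metis converse_iff i_iff T_unique V_inv_V)
  have "Domain i = V ` Range T"
    by (force simp: i_iff)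
  then show "dense (Domain i)"
    by (simp add: unitary_image_dense V ran)
  have "i = (\<lambda>p. (snd p, inv V (fst p))) -` T"
    by (auto simp: i_iff)
  moreover have "closed \<dots>"
    by (intro closed_vimage closed continuous_intros
        continuous_on_compose2[OF unitary_continuous[OF unitary_inv[OF V]]]) auto
  ultimately show "closed i" by simp
qed

lemma Range_i: "Range i = Domain T"
  using i_iff[of "V _"] by (auto simp: i_iff) (metis RangeI inv_V_V i_iff)

lemma closed_embedding_j_inverse: "closed_embedding (j\<inverse>)"
  unfolding closed_embedding_def
proof (intro conjI)
  show "linear_operator (j\<inverse>)"
    unfolding linear_operator_def
  proof (intro conjI allI impI)
    show "single_valued (j\<inverse>)"
      by (rule single_valuedI) (metis converse_iff j_iff adj_unique U_inv_U)
  qed (use unitaryD[OF unitary_inv[OF U]] unitary_0[OF unitary_inv[OF U]] in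
      \<open>auto simp: j_iff intro: linear_operator_0 linear_operator_add linear_operator_scaleC lin_adj\<close>)
  show "injective_op (j\<inverse>)"
    unfolding injective_op_def
    by (rule single_valuedI) (metis converse_converse j_iff linear_operator_unique[OF lin_adj])
  have "Domain (j\<inverse>) = Range (adj T)"
    by (auto simp: j_iff) (metis RangeI inv_U_U j_iff)
  then show "dense (Domain (j\<inverse>))"
    by (simp add: dense_Range_adj lin closed dom inj)
  have "j\<inverse> = (\<lambda>p. (inv U (snd p), fst p)) -` adj T"
    by (auto simp: j_iff)
  moreover have "closed \<dots>"
    by (intro closed_vimage closed_adj continuous_intros
        continuous_on_compose2[OF unitary_continuous[OF unitary_inv[OF U]]]) auto
  ultimately show "closed (j\<inverse>)" by simp
qed

lemma Domain_j: "Domain j = U ` Domain (adj T)"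
  by (force simp: j_iff)

lemma kernel_op_i: "kernel_op i = (adj T \<circ>\<^sub>o T)\<inverse>"
  unfolding kernel_op_def
proof (rule set_eqI, clarify)
  fix z x
  have "(z, x) \<in> i \<circ>\<^sub>o adj i \<longleftrightarrow> (\<exists>a. (inv V a, z) \<in> adj T \<and> (x, inv V a) \<in> T)"
    by (auto simp: adj_i_iff i_iff)
  then show "(z, x) \<in> i \<circ>\<^sub>o adj i \<longleftrightarrow> (z, x) \<in> (adj T \<circ>\<^sub>o T)\<inverse>"
    by (metis converse_iff inv_V_V relcomp.cases relcompI)
qed

text \<open>In \<open>kernel_op i\<close> the unitary \<open>V\<close> cancels, whereas here
  \<open>U\<close> remains outside: the kernel operator is the inverse of \<open>T T\<^sup>*\<close>
  conjugated by \<open>U\<close>.\<close>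

lemma kernel_op_j_inverse_iff:
  "(b, c) \<in> kernel_op (j\<inverse>) \<longleftrightarrow> (inv U c, inv U b) \<in> T \<circ>\<^sub>o adj T"
  by (auto simp: kernel_op_def adj_j_inverse_iff j_iff)

lemma unitarily_equivalent_kernel_ops:
  "unitarily_equivalent (kernel_op i) (kernel_op (j\<inverse>))"
proof -
  obtain W where W: "unitary W"
    and W_iff: "\<And>x z. (W x, W z) \<in> T \<circ>\<^sub>o adj T \<longleftrightarrow> (x, z) \<in> adj T \<circ>\<^sub>o T"
    using unitary_equivalence_comp_adj by blast
  have UW: "unitary (U \<circ> W)" by (rule unitary_comp[OF U W])
  have *: "((U \<circ> W) z, (U \<circ> W) x) \<in> kernel_op (j\<inverse>) \<longleftrightarrow> (z, x) \<in> kernel_op i" for z x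
    by (simp add: kernel_op_j_inverse_iff kernel_op_i W_iff)
  have "kernel_op (j\<inverse>) = {((U \<circ> W) z, (U \<circ> W) x) |z x. (z, x) \<in> kernel_op i}"
  proof (rule set_eqI, clarify)
    fix b c
    show "(b, c) \<in> kernel_op (j\<inverse>) \<longleftrightarrow>
        (b, c) \<in> {((U \<circ> W) z, (U \<circ> W) x) |z x. (z, x) \<in> kernel_op i}"
      using *[of "inv (U \<circ> W) b" "inv (U \<circ> W) c"] *
      by (simp add: unitary_f_inv[OF UW] del: o_apply) (metis unitary_f_inv[OF UW])
  qed
  with UW show ?thesis unfolding unitarily_equivalent_def by blast
qed

text \<open>The image under \<open>T\<close> of the domain of \<open>T\<^sup>* T\<close>. It is
  dense because it contains the range of \<open>op_resolvent T\<close>.\<close>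

definition core :: "'g set"
  where "core = Domain (adj T) \<inter> Range T"

lemma dense_core: "dense core"
proof -
  have "range (op_resolvent T) \<subseteq> core"
    using op_resolvent adj_op_resolvent by (auto simp: core_def)
  then show ?thesis
    by (rule dense_mono[OF dense_range_op_resolvent])
qed

text \<open>If \<open>x\<close> is the vector embedded from \<open>a\<close>, then
  \<open>T x = V\<inverse> a\<close>, and \<open>T\<^sup>* T x\<close> regarded in the completed
  range is \<open>U T x\<close>. Thus the operator is \<open>U V\<inverse>\<close> restricted to the
  image of \<open>core\<close> under \<open>V\<close>.\<close>

lemma restricted_H_iff:
  "(a, b) \<in> j\<inverse> \<circ>\<^sub>o (adj T \<circ>\<^sub>o T) \<circ>\<^sub>o i \<longleftrightarrow> inv U b = inv V a \<and> inv V a \<in> core"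
proof
  assume "(a, b) \<in> j\<inverse> \<circ>\<^sub>o (adj T \<circ>\<^sub>o T) \<circ>\<^sub>o i"
  then obtain x u z where x: "(x, inv V a) \<in> T" "(x, u) \<in> T"
    and z: "(u, z) \<in> adj T" "(inv U b, z) \<in> adj T"
    by (auto simp: i_iff j_iff)
  then have "u = inv V a" "u = inv U b" using T_unique adj_unique by blast+
  with x z show "inv U b = inv V a \<and> inv V a \<in> core" by (auto simp: core_def)
next
  assume *: "inv U b = inv V a \<and> inv V a \<in> core"
  then obtain x z where "(x, inv V a) \<in> T" "(inv V a, z) \<in> adj T"
    by (auto simp: core_def)
  with * show "(a, b) \<in> j\<inverse> \<circ>\<^sub>o (adj T \<circ>\<^sub>o T) \<circ>\<^sub>o i"
    by (auto simp: i_iff j_iff intro!: relcompI)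
qed

lemma restricted_H:
  defines "Hv \<equiv> j\<inverse> \<circ>\<^sub>o (adj T \<circ>\<^sub>o T) \<circ>\<^sub>o i"
  shows "linear_operator Hv" and "dense (Domain Hv)" and "dense (Range Hv)"
    and "isometric_op Hv" and "unitary_extensions Hv = {U \<circ> inv V}"
    and "unitary_extensions (Hv\<inverse>) = {V \<circ> inv U}"
proof -
  have iff: "(a, b) \<in> Hv \<longleftrightarrow> inv U b = inv V a \<and> inv V a \<in> core" for a b
    unfolding Hv_def by (rule restricted_H_iff)
  have fwd: "b = (U \<circ> inv V) a" and bwd: "a = (V \<circ> inv U) b" if "(a, b) \<in> Hv" for a b
    using that by (metis iff U_inv_U V_inv_V comp_apply)+
  have core_0: "0 \<in> core"
    using linear_operator_0[OF lin] linear_operator_0[OF lin_adj] unfolding core_def by blast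
  have core_add: "u + v \<in> core" if "u \<in> core" "v \<in> core" for u v
    using that linear_operator_add[OF lin] linear_operator_add[OF lin_adj]
    unfolding core_def by blast
  have core_scale: "c *\<^sub>C u \<in> core" if "u \<in> core" for u c
    using that linear_operator_scaleC[OF lin] linear_operator_scaleC[OF lin_adj]
    unfolding core_def by blast
  note V' = unitary_inv[OF V] and U' = unitary_inv[OF U]
  show "linear_operator Hv"
    unfolding linear_operator_def
  proof (intro conjI allI impI)
    show "single_valued Hv" by (rule single_valuedI) (metis fwd)
    show "(0, 0) \<in> Hv"
      using core_0 by (simp add: iff unitary_0 V' U')
  qed (simp_all add: iff unitary_add unitary_scaleC V' U' core_add core_scale)
  have "(V u, U u) \<in> Hv" if "u \<in> core" for u
    using that by (simp add: iff)
  then have "V ` core \<subseteq> Domain Hv" "U ` core \<subseteq> Range Hv"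
    by blast+
  then show dom_Hv: "dense (Domain Hv)" and ran_Hv: "dense (Range Hv)"
    using unitary_image_dense[OF V dense_core] unitary_image_dense[OF U dense_core]
    by (blast intro: dense_mono)+
  show "isometric_op Hv"
    by (auto simp: isometric_op_def unitary_norm unitary_comp U V' dest!: fwd)
  show "unitary_extensions Hv = {U \<circ> inv V}"
    by (intro unitary_extensions_eq_singleton unitary_comp U V' dom_Hv fwd)
  show "unitary_extensions (Hv\<inverse>) = {V \<circ> inv U}"
    using ran_Hv by (intro unitary_extensions_eq_singleton unitary_comp V U' bwd) auto
qed

text \<open>In the product, \<open>T\<^sup>*\<close> meets its own inverse, leaving
  \<open>V U\<inverse>\<close> on the whole domain of \<open>j\<close>, which is dense.\<close>

lemma unitary_extensions_adj_i_j: "unitary_extensions (adj i \<circ>\<^sub>o j) = {V \<circ> inv U}"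
proof (intro unitary_extensions_eq_singleton unitary_comp unitary_inv V U)
  have "U ` Domain (adj T) \<subseteq> Domain (adj i \<circ>\<^sub>o j)"
  proof clarify
    fix y z assume "(y, z) \<in> adj T"
    then have "(U y, z) \<in> j" "(z, V y) \<in> adj i" by (simp_all add: j_iff adj_i_iff)
    then show "U y \<in> Domain (adj i \<circ>\<^sub>o j)" by blast
  qed
  moreover have "dense (U ` Domain (adj T))"
    by (intro unitary_image_dense U dense_Domain_adj lin closed dom)
  ultimately show "dense (Domain (adj i \<circ>\<^sub>o j))"
    by (blast intro: dense_mono)
  fix b a assume "(b, a) \<in> adj i \<circ>\<^sub>o j"
  then have "inv U b = inv V a"
    by (auto simp: j_iff adj_i_iff intro: adj_unique)
  then show "a = (V \<circ> inv U) b" by simp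
qed

text \<open>The factorization fixes \<open>V'\<close> on the dense range of \<open>T\<close>, since
  \<open>T\<close> is single-valued. For \<open>U\<close>, below, the dense domain of the adjoint
  and its injectivity play this role.\<close>

lemma unitary_factor_V: "(\<exists>!V'. unitary V' \<and> T\<inverse> = i \<circ>\<^sub>o graph_of V')"
  and unitary_factor_V_iff: "unitary V' \<and> T\<inverse> = i \<circ>\<^sub>o graph_of V' \<longleftrightarrow> V' = V"
proof -
  have V_factor: "T\<inverse> = i \<circ>\<^sub>o graph_of V"
    by (auto simp: graph_of_def i_iff)
  have unique: "W = V" if W: "unitary W" and eq: "T\<inverse> = i \<circ>\<^sub>o graph_of W" for W
  proof (rule unitary_eqI[OF W V ran])
    fix u assume "u \<in> Range T"
    then obtain x where x: "(x, u) \<in> T" by blast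
    then have "(u, x) \<in> i \<circ>\<^sub>o graph_of W" using eq by blast
    then have "(x, inv V (W u)) \<in> T" by (auto simp: graph_of_def i_iff)
    then have "inv V (W u) = u" using x T_unique by blast
    then show "W u = V u" by (metis V_inv_V)
  qed
  have factor: "unitary V \<and> T\<inverse> = i \<circ>\<^sub>o graph_of V"
    by (rule conjI[OF V V_factor])
  have iff: "unitary W \<and> T\<inverse> = i \<circ>\<^sub>o graph_of W \<longleftrightarrow> W = V" for W
  proof
    show "W = V" if "unitary W \<and> T\<inverse> = i \<circ>\<^sub>o graph_of W"
      using that unique by blast
    show "unitary W \<and> T\<inverse> = i \<circ>\<^sub>o graph_of W" if "W = V"
      unfolding that by (rule factor)
  qed
  show "\<exists>!V'. unitary V' \<and> T\<inverse> = i \<circ>\<^sub>o graph_of V'"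
    by (simp only: iff ex1_eq)
  show "unitary V' \<and> T\<inverse> = i \<circ>\<^sub>o graph_of V' \<longleftrightarrow> V' = V"
    by (rule iff)
qed

lemma unitary_factor_U: "(\<exists>!U'. unitary U' \<and> adj T = j \<circ>\<^sub>o graph_of U')"
  and unitary_factor_U_iff: "unitary U' \<and> adj T = j \<circ>\<^sub>o graph_of U' \<longleftrightarrow> U' = U"
proof -
  have U_factor: "adj T = j \<circ>\<^sub>o graph_of U"
    by (auto simp: graph_of_def j_iff)
  have unique: "W = U" if W: "unitary W" and eq: "adj T = j \<circ>\<^sub>o graph_of W" for W
  proof (rule unitary_eqI[OF W U dense_Domain_adj[OF lin closed dom]])
    fix y assume "y \<in> Domain (adj T)"
    then obtain z where z: "(y, z) \<in> adj T" by blast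
    then have "(y, z) \<in> j \<circ>\<^sub>o graph_of W" using eq by blast
    then have "(inv U (W y), z) \<in> adj T" by (auto simp: graph_of_def j_iff)
    then have "inv U (W y) = y" using z adj_unique by blast
    then show "W y = U y" by (metis U_inv_U)
  qed
  have factor: "unitary U \<and> adj T = j \<circ>\<^sub>o graph_of U"
    by (rule conjI[OF U U_factor])
  have iff: "unitary W \<and> adj T = j \<circ>\<^sub>o graph_of W \<longleftrightarrow> W = U" for W
  proof
    show "W = U" if "unitary W \<and> adj T = j \<circ>\<^sub>o graph_of W"
      using that unique by blast
    show "unitary W \<and> adj T = j \<circ>\<^sub>o graph_of W" if "W = U"
      unfolding that by (rule factor)
  qed
  show "\<exists>!U'. unitary U' \<and> adj T = j \<circ>\<^sub>o graph_of U'"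
    by (simp only: iff ex1_eq)
  show "unitary U' \<and> adj T = j \<circ>\<^sub>o graph_of U' \<longleftrightarrow> U' = U"
    by (rule iff)
qed

end

text \<open>Substituting \<open>u = T x\<close> turns the pairing of \<open>y = T\<^sup>* w\<close>
  with \<open>x\<close> into that of \<open>w\<close> with \<open>u\<close>, so the supremum becomes
  the one for \<open>norm w\<close> over the dense range of \<open>T\<close>.\<close>

lemma norm_eq_SUP_adj:
  assumes lin: "linear_operator T" and inj: "\<And>x. (x, 0) \<in> T \<Longrightarrow> x = 0"
    and ran: "dense (Range T)" and \<iota>: "\<And>x u. (x, u) \<in> T \<Longrightarrow> norm (\<iota> x) = norm u"
    and wy: "(w, y) \<in> adj T"
  shows "ennreal (norm w) = (SUP x \<in> Domain T - {0}. ennreal (cmod (cinner y x) / norm (\<iota> x)))"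
proof -
  let ?f = "\<lambda>x. ennreal (cmod (cinner y x) / norm (\<iota> x))"
    and ?g = "\<lambda>u. ennreal (cmod (cinner w u) / norm u)"
  have fg: "?f x = ?g u" if "(x, u) \<in> T" for x u
    by (simp add: \<iota>[OF that] adjD'[OF wy that])
  have nz: "x = 0 \<longleftrightarrow> u = 0" if "(x, u) \<in> T" for x u
    using that inj linear_operator_unique[OF lin that] linear_operator_0[OF lin] by blast
  have "?f ` (Domain T - {0}) = ?g ` (Range T - {0})"
  proof (intro equalityI subsetI)
    fix r assume "r \<in> ?f ` (Domain T - {0})"
    then obtain x u where "(x, u) \<in> T" "x \<noteq> 0" "r = ?f x" by blast
    then have "u \<in> Range T - {0}" "r = ?g u" using nz fg[of x u] by auto
    then show "r \<in> ?g ` (Range T - {0})" by blast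
  next
    fix r assume "r \<in> ?g ` (Range T - {0})"
    then obtain x u where "(x, u) \<in> T" "u \<noteq> 0" "r = ?g u" by blast
    then have "x \<in> Domain T - {0}" "r = ?f x" using nz fg[of x u] by auto
    then show "r \<in> ?f ` (Domain T - {0})" by blast
  qed
  then show ?thesis by (simp add: norm_eq_SUP_dense[OF ran])
qed

section \<open>Specialization to the given completions \<open>\<iota>\<^sub>D\<close> and
  \<open>\<iota>\<^sub>R\<close>\<close>

theorem theorem4p1:
  fixes H :: "('h::complex_hilbert, 'h) op"
    and T :: "('h, 'g::complex_hilbert) op"
    and \<iota>\<^sub>D :: "'h \<Rightarrow> 'd::complex_hilbert"
    and \<iota>\<^sub>R :: "'h \<Rightarrow> 'r::complex_hilbert"
  assumes "selfadjoint H" and "positive_op H" and "null_space H = {0}"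
    and "linear_operator T" and "closed T" and "dense (Domain T)"
    and "dense (Range T)" and "H = adj T \<circ>\<^sub>o T"
    and "is_D_space T \<iota>\<^sub>D" and "is_R_space (adj T) \<iota>\<^sub>R"
  defines "i \<equiv> i_op T \<iota>\<^sub>D" and "j \<equiv> j_op (adj T) \<iota>\<^sub>R"
  defines "A \<equiv> kernel_op i" and "B \<equiv> kernel_op (j\<inverse>)"
  defines "H\<^sub>v \<equiv> j\<inverse> \<circ>\<^sub>o H \<circ>\<^sub>o i" \<comment> \<open>\<open>H\<close> viewed as an operator from \<open>\<D>(T)\<close> to \<open>\<R>(T\<^sup>*)\<close>\<close>
  shows
    \<comment> \<open>(i)\<close>
    "(closed_embedding i \<and> dense (Range i) \<and> A = H\<inverse>) \<and>
     \<comment> \<open>(ii)\<close>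
     (closed_embedding (j\<inverse>) \<and> dense (Range (j\<inverse>)) \<and> unitarily_equivalent A B) \<and>
     (\<exists>A\<^sub>u H\<^sub>u.
      \<comment> \<open>(iii)\<close>
      (Range (adj T) \<subseteq> Domain (adj i) \<and>
       unitary_extensions (adj i \<circ>\<^sub>o j) = {A\<^sub>u} \<and>
       Domain A \<subseteq> Range (adj T) \<and> Range A \<subseteq> Domain T \<and>
       unitary_extensions (i\<inverse> \<circ>\<^sub>o A \<circ>\<^sub>o j) = {A\<^sub>u}) \<and>
      \<comment> \<open>(iv)\<close>
      (Domain H \<subseteq> Domain T \<and> Range H \<subseteq> Range (adj T) \<and>
       linear_operator H\<^sub>v \<and> dense (Domain H\<^sub>v) \<and> dense (Range H\<^sub>v) \<and> isometric_op H\<^sub>v \<and>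
       unitary_extensions H\<^sub>v = {H\<^sub>u} \<and>
       H\<^sub>u \<circ> A\<^sub>u = id \<and> A\<^sub>u \<circ> H\<^sub>u = id) \<and>
      \<comment> \<open>(v)\<close>
      ((\<exists>!V. unitary V \<and> T\<inverse> = i \<circ>\<^sub>o graph_of V) \<and>
       (\<exists>!U. unitary U \<and> adj T = j \<circ>\<^sub>o graph_of U) \<and>
       (\<forall>V U. unitary V \<and> T\<inverse> = i \<circ>\<^sub>o graph_of V \<and>
              unitary U \<and> adj T = j \<circ>\<^sub>o graph_of U \<longrightarrow> H\<^sub>u = U \<circ> inv V)) \<and>
      \<comment> \<open>(vi)\<close>
      (unitary_onto_conj_dual (\<lambda>\<alpha> x. cinner (A\<^sub>u \<alpha>) x) \<and>
       (\<forall>y \<in> Range (adj T).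
          ennreal (norm (\<iota>\<^sub>R y)) =
            (SUP x \<in> Domain T - {0}. ennreal (cmod (cinner y x) / norm (\<iota>\<^sub>D x))))))"
proof -
  note H = \<open>H = adj T \<circ>\<^sub>o T\<close>
  have inj: "x = 0" if "(x, 0) \<in> T" for x
  proof -
    have "(x, 0) \<in> H"
      unfolding H using that linear_operator_0[OF linear_operator_adj[OF \<open>dense (Domain T)\<close>]] by blast
    with \<open>null_space H = {0}\<close> show ?thesis by (auto simp: null_space_def)
  qed
  interpret T: injective_closed_operator T
    by unfold_locales (fact | rule inj)+
  interpret T': injective_closed_operator "adj T"
    by (rule T.injective_closed_operator_adj)
  obtain V where V: "unitary V" and V_eq: "\<And>x u. (x, u) \<in> T \<Longrightarrow> V u = \<iota>\<^sub>D x"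
    using D_space_unitary[OF T.lin T.ran \<open>is_D_space T \<iota>\<^sub>D\<close>] by blast
  obtain U where U: "unitary U" and U_eq: "\<And>y z. (y, z) \<in> adj T \<Longrightarrow> U y = \<iota>\<^sub>R z"
    using R_space_unitary[OF T'.lin T'.inj T'.dom \<open>is_R_space (adj T) \<iota>\<^sub>R\<close>] by blast
  interpret operator_spaces T V U i j
  proof unfold_locales
    show "(a, x) \<in> i \<longleftrightarrow> (x, inv V a) \<in> T" for a x
      unfolding i_def i_op_def using V_eq V by (auto simp flip: V_eq)
    show "(b, z) \<in> j \<longleftrightarrow> (inv U b, z) \<in> adj T" for b z
      unfolding j_def j_op_def using U_eq U by (auto simp flip: U_eq)
  qed (fact V U)+
  have A: "A = H\<inverse>" unfolding A_def H by (rule kernel_op_i)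
  have H\<^sub>v: "H\<^sub>v = j\<inverse> \<circ>\<^sub>o (adj T \<circ>\<^sub>o T) \<circ>\<^sub>o i" by (simp add: H\<^sub>v_def H)
  \<comment> \<open>Because \<open>A\<close> is the inverse of \<open>H\<close>, viewing
    \<open>A\<close> between the two completions gives the converse of \<open>H\<^sub>v\<close>;
    \<open>restricted_H\<close> thereby settles the extensions in both (iii) and (iv).\<close>
  have Hv_inverse: "i\<inverse> \<circ>\<^sub>o A \<circ>\<^sub>o j = H\<^sub>v\<inverse>"
    by (simp add: H\<^sub>v_def A converse_relcomp O_assoc)
  have norm_\<iota>\<^sub>R: "norm (\<iota>\<^sub>R y) = norm w" if "(w, y) \<in> adj T" for w y
    using U_eq[OF that] unitary_norm[OF U] by metis
  have norm_\<iota>\<^sub>D: "norm (\<iota>\<^sub>D x) = norm u" if "(x, u) \<in> T" for x u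
    using V_eq[OF that] unitary_norm[OF V] by metis
  have inv_eq: "(U \<circ> inv V) \<circ> (V \<circ> inv U) = id" "(V \<circ> inv U) \<circ> (U \<circ> inv V) = id"
    by (simp_all add: fun_eq_iff)
  have i: "closed_embedding i \<and> dense (Range i) \<and> A = H\<inverse>"
    by (simp add: closed_embedding_i Range_i T.dom A)
  have ii: "closed_embedding (j\<inverse>) \<and> dense (Range (j\<inverse>)) \<and> unitarily_equivalent A B"
    using unitarily_equivalent_kernel_ops
    by (simp add: closed_embedding_j_inverse Domain_j unitary_image_dense U T'.dom A_def B_def)
  have iii: "Range (adj T) \<subseteq> Domain (adj i) \<and>
      unitary_extensions (adj i \<circ>\<^sub>o j) = {V \<circ> inv U} \<and>
      Domain A \<subseteq> Range (adj T) \<and> Range A \<subseteq> Domain T \<and>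
      unitary_extensions (i\<inverse> \<circ>\<^sub>o A \<circ>\<^sub>o j) = {V \<circ> inv U}"
  proof (intro conjI)
    show "Range (adj T) \<subseteq> Domain (adj i)"
      using adj_i_iff[of _ "V _"] by auto
  qed (auto simp: unitary_extensions_adj_i_j Hv_inverse H\<^sub>v restricted_H, auto simp: A H)
  have iv: "Domain H \<subseteq> Domain T \<and> Range H \<subseteq> Range (adj T) \<and>
      linear_operator H\<^sub>v \<and> dense (Domain H\<^sub>v) \<and> dense (Range H\<^sub>v) \<and> isometric_op H\<^sub>v \<and>
      unitary_extensions H\<^sub>v = {U \<circ> inv V} \<and>
      (U \<circ> inv V) \<circ> (V \<circ> inv U) = id \<and> (V \<circ> inv U) \<circ> (U \<circ> inv V) = id"
    unfolding H\<^sub>v inv_eq by (auto simp: restricted_H H)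
  have v: "(\<exists>!V. unitary V \<and> T\<inverse> = i \<circ>\<^sub>o graph_of V) \<and>
      (\<exists>!U. unitary U \<and> adj T = j \<circ>\<^sub>o graph_of U) \<and>
      (\<forall>V' U'. unitary V' \<and> T\<inverse> = i \<circ>\<^sub>o graph_of V' \<and>
        unitary U' \<and> adj T = j \<circ>\<^sub>o graph_of U' \<longrightarrow> U \<circ> inv V = U' \<circ> inv V')"
  proof (intro conjI unitary_factor_V unitary_factor_U allI impI)
    fix V' U'
    assume "unitary V' \<and> T\<inverse> = i \<circ>\<^sub>o graph_of V' \<and>
      unitary U' \<and> adj T = j \<circ>\<^sub>o graph_of U'"
    then have "V' = V" "U' = U"
      using unitary_factor_V_iff unitary_factor_U_iff by blast+
    then show "U \<circ> inv V = U' \<circ> inv V'" by simp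
  qed
  have vi: "unitary_onto_conj_dual (\<lambda>\<alpha> x. cinner ((V \<circ> inv U) \<alpha>) x) \<and>
      (\<forall>y \<in> Range (adj T). ennreal (norm (\<iota>\<^sub>R y)) =
        (SUP x \<in> Domain T - {0}. ennreal (cmod (cinner y x) / norm (\<iota>\<^sub>D x))))"
  proof (intro conjI ballI)
    show "unitary_onto_conj_dual (\<lambda>\<alpha> x. cinner ((V \<circ> inv U) \<alpha>) x)"
      by (intro unitary_onto_conj_dual_cinner unitary_comp unitary_inv V U)
    fix y assume "y \<in> Range (adj T)"
    then obtain w where w: "(w, y) \<in> adj T" by blast
    show "ennreal (norm (\<iota>\<^sub>R y)) =
        (SUP x \<in> Domain T - {0}. ennreal (cmod (cinner y x) / norm (\<iota>\<^sub>D x)))"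
      unfolding norm_\<iota>\<^sub>R[OF w] by (rule norm_eq_SUP_adj[OF T.lin inj T.ran norm_\<iota>\<^sub>D w])
  qed
  show ?thesis
    by (intro conjI[OF i] conjI[OF ii] exI[of _ "V \<circ> inv U"] exI[of _ "U \<circ> inv V"]
        conjI[OF iii] conjI[OF iv] conjI[OF v] vi)
qed

end
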